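(* The elements $g_\lambda$, $\lambda$ ranging over all partitions, form a ($\mathbb Z$-)basis for the ring $\mathrm{Sym}$ of symmetric functions. Thus $\mathfrak M\mathrm{Sym}\simeq\mathrm{Sym}$.
   Context: $\mathrm{Sym}$ is the ring of symmetric functions over $\mathbb Z$ in $x_1,x_2,\dots$. A reverse plane partition $T$ of shape $\lambda$ (Young diagram in English notation) is a filling of the boxes of $\lambda$ with positive integers weakly increasing along rows and down columns. Define $x^T=\prod_{i\ge1}x_i^{T(i)}$, where $T(i)$ is the number of columns of $T$ containing one or more entries equal to $i$. Then $g_\lambda=\sum_T x^T$ over all reverse plane partitions $T$ of shape $\lambda$ (this is a symmetric function). $\mathfrak M\mathrm{Sym}=\bigoplus_\lambda\mathbb Z g_\lambda$ is the $\mathbb Z$-module of finite $\mathbb Z$-linear combinations of the $g_\lambda$. *)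

theory Defs
  imports Complex_Main "HOL-Library.Poly_Mapping" "HOL-Combinatorics.Permutations"
begin

text \<open>
  Formal power series with integer coefficients in the variables $x_1, x_2, \dots$.
  A monomial is a finitely supported exponent vector; the exponent of $x_{k+1}$ is stored at
  index \<open>k\<close>.
\<close>

type_synonym monomial = "nat \<Rightarrow>\<^sub>0 nat"

typedef series = "UNIV :: (monomial \<Rightarrow> int) set"
  morphisms coeff Series ..

setup_lifting type_definition_series

lemma series_eqI: "(\<And>m. coeff f m = coeff g m) \<Longrightarrow> f = g"
  by (metis coeff_inject ext)

definition splits :: "monomial \<Rightarrow> (monomial \<times> monomial) set" where
  "splits m = {(a, b). a + b = m}"

lemma finite_below: "finite {a :: monomial. \<exists>b. a + b = m}"
proof -
  let ?S = "Poly_Mapping.keys m"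
  let ?F = "{f. \<forall>k. (k \<in> ?S \<longrightarrow> f k \<in> {..Poly_Mapping.lookup m k}) \<and> (k \<notin> ?S \<longrightarrow> f k = 0)}"
  have "finite {..Max (Poly_Mapping.lookup m ` ?S)}"
    by simp
  have "finite ?F"
  proof (rule finite_subset)
    show "?F \<subseteq> {f. \<forall>k. (k \<in> ?S \<longrightarrow> f k \<in> {..Max (Poly_Mapping.lookup m ` ?S)})
        \<and> (k \<notin> ?S \<longrightarrow> f k = 0)}"
      by (auto intro: order_trans[OF _ Max_ge[OF _ imageI]])
    show "finite \<dots>"
      by (rule finite_set_of_finite_funs) auto
  qed
  moreover have "Poly_Mapping.lookup ` {a. \<exists>b. a + b = m} \<subseteq> ?F"
    by (auto simp: lookup_add in_keys_iff)
  ultimately have "finite (Poly_Mapping.lookup ` {a. \<exists>b. a + b = m})"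
    by (rule finite_subset[rotated])
  then show ?thesis
    by (rule finite_imageD) (auto simp: inj_on_def lookup_inject)
qed

lemma finite_splits [simp]: "finite (splits m)"
proof (rule finite_subset)
  show "splits m \<subseteq> {a. \<exists>b. a + b = m} \<times> {a. \<exists>b. a + b = m}"
    by (auto simp: splits_def) (metis add.commute)
qed (simp add: finite_below)

instantiation series :: comm_ring_1
begin

lift_definition zero_series :: series is "\<lambda>_. 0" .
lift_definition one_series :: series is "\<lambda>m. if m = 0 then 1 else 0" .
lift_definition plus_series :: "series \<Rightarrow> series \<Rightarrow> series" is "\<lambda>f g m. f m + g m" .
lift_definition uminus_series :: "series \<Rightarrow> series" is "\<lambda>f m. - f m" .
lift_definition minus_series :: "series \<Rightarrow> series \<Rightarrow> series" is "\<lambda>f g m. f m - g m" .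
lift_definition times_series :: "series \<Rightarrow> series \<Rightarrow> series"
  is "\<lambda>f g m. \<Sum>(a, b)\<in>splits m. f a * g b" .

instance
proof
  fix f g h :: series
  show "f * g * h = f * (g * h)"
  proof (rule series_eqI)
    fix m
    let ?T = "\<lambda>(a, b, c). coeff f a * coeff g b * coeff h c"
    have "coeff (f * g * h) m =
        (\<Sum>(d, c)\<in>splits m. \<Sum>(a, b)\<in>splits d. coeff f a * coeff g b * coeff h c)"
      by (simp add: times_series.rep_eq sum_distrib_right case_prod_unfold)
    also have "\<dots> = sum ?T {(a, b, c). a + b + c = m}"
      unfolding case_prod_unfold
      by (subst sum.Sigma, simp, simp)
        (rule sum.reindex_bij_witness[where
            i = "\<lambda>(a, b, c). ((a + b, c), (a, b))" and j = "\<lambda>((d, c), (a, b)). (a, b, c)"],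
          auto simp: splits_def)
    also have "\<dots> = (\<Sum>(a, d)\<in>splits m. \<Sum>(b, c)\<in>splits d. coeff f a * coeff g b * coeff h c)"
      unfolding case_prod_unfold
      by (subst sum.Sigma, simp, simp)
        (rule sum.reindex_bij_witness[where
            j = "\<lambda>(a, b, c). ((a, b + c), (b, c))" and i = "\<lambda>((a, d), (b, c)). (a, b, c)"],
          auto simp: splits_def add.assoc)
    also have "\<dots> = coeff (f * (g * h)) m"
      by (simp add: times_series.rep_eq sum_distrib_left case_prod_unfold mult.assoc)
    finally show "coeff (f * g * h) m = coeff (f * (g * h)) m" .
  qed
  show "f * g = g * f"
    by (rule series_eqI, unfold times_series.rep_eq)
      (rule sum.reindex_bij_witness[where i = prod.swap and j = prod.swap],
        auto simp: splits_def add.commute mult.commute)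
  show "1 * f = f"
  proof (rule series_eqI)
    fix m
    have "coeff (1 * f) m = (\<Sum>(a, b)\<in>splits m. if a = 0 then coeff f b else 0)"
      by (auto simp: times_series.rep_eq one_series.rep_eq intro!: sum.cong)
    also have "\<dots> = (\<Sum>(a, b)\<in>{(0::monomial, m)}. coeff f b)"
      by (rule sum.mono_neutral_cong_right, simp)
        (auto simp: splits_def split: if_splits)
    finally show "coeff (1 * f) m = coeff f m"
      by simp
  qed
  show "(f + g) * h = f * h + g * h"
    by (rule series_eqI)
      (simp add: times_series.rep_eq plus_series.rep_eq case_prod_unfold algebra_simps sum.distrib)
  have "coeff (0::series) 0 \<noteq> coeff 1 0"
    by (simp add: zero_series.rep_eq one_series.rep_eq)
  then show "(0::series) \<noteq> 1"
    by metis
qed (auto intro!: series_eqI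
    simp: zero_series.rep_eq plus_series.rep_eq uminus_series.rep_eq minus_series.rep_eq)

end

lemma coeff_sum: "coeff (sum F A) m = (\<Sum>a\<in>A. coeff (F a) m)"
  by (induction A rule: infinite_finite_induct)
    (simp_all add: zero_series.rep_eq plus_series.rep_eq)

lemma coeff_of_int_mult: "coeff (of_int c * f) m = c * coeff f m"
proof -
  have *: "coeff (of_nat n * f) m = int n * coeff f m" for n
    by (induction n) (simp_all add: zero_series.rep_eq plus_series.rep_eq distrib_right)
  show ?thesis
    by (cases c rule: int_cases2) (simp_all add: * uminus_series.rep_eq)
qed

text \<open>The power series ring as a \<open>\<int>\<close>-module.\<close>

global_interpretation Zmod: module "\<lambda>(c::int) (f::series). of_int c * f"
  by unfold_locales (simp_all add: algebra_simps)

text \<open>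
  \<open>map_key \<pi>\<close> precomposes the exponent vector with \<open>\<pi>\<close>; since \<open>\<pi>\<close> runs through all finitary
  permutations it does not matter whether \<open>\<pi>\<close> or its inverse is used.
\<close>

definition symmetric :: "series \<Rightarrow> bool" where
  "symmetric f \<longleftrightarrow>
     (\<forall>\<pi> m. permutation \<pi> \<longrightarrow> coeff f (Poly_Mapping.map_key \<pi> m) = coeff f m)"

definition mdegree :: "monomial \<Rightarrow> nat" where
  "mdegree m = (\<Sum>k\<in>Poly_Mapping.keys m. Poly_Mapping.lookup m k)"

definition bounded_degree :: "series \<Rightarrow> bool" where
  "bounded_degree f \<longleftrightarrow> (\<exists>d. \<forall>m. coeff f m \<noteq> 0 \<longrightarrow> mdegree m \<le> d)"

definition Sym :: "series set" where
  "Sym = {f. symmetric f \<and> bounded_degree f}"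

lemma mdegree_zero [simp]: "mdegree 0 = 0"
  by (simp add: mdegree_def)

lemma mdegree_add: "mdegree (a + b) = mdegree a + mdegree b"
proof -
  let ?K = "Poly_Mapping.keys a \<union> Poly_Mapping.keys b"
  have *: "mdegree c = (\<Sum>k\<in>?K. Poly_Mapping.lookup c k)" if "Poly_Mapping.keys c \<subseteq> ?K" for c
    unfolding mdegree_def using that
    by (intro sum.mono_neutral_left) (auto simp: in_keys_iff)
  have "Poly_Mapping.keys (a + b) \<subseteq> ?K"
    by (rule Poly_Mapping.keys_add)
  then show ?thesis
    by (simp add: * lookup_add sum.distrib)
qed

text \<open>\<open>Sym\<close> is a subring of the ring of power series.\<close>

lemma Sym_zero: "0 \<in> Sym"
  by (simp add: Sym_def symmetric_def bounded_degree_def zero_series.rep_eq)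

lemma map_key_eq_zero_iff:
  assumes "permutation \<pi>"
  shows "Poly_Mapping.map_key \<pi> m = 0 \<longleftrightarrow> m = 0"
proof -
  have "bij \<pi>"
    using assms by (rule permutation_bijective)
  then have "inj \<pi>" and \<pi>: "\<pi> (inv \<pi> k) = k" for k
    by (auto simp: bij_def surj_f_inv_f)
  then have lookup: "Poly_Mapping.lookup (Poly_Mapping.map_key \<pi> m) k = Poly_Mapping.lookup m (\<pi> k)" for k
    by (simp add: map_key.rep_eq)
  have "m = 0" if "Poly_Mapping.map_key \<pi> m = 0"
  proof (rule poly_mapping_eqI)
    fix k
    show "Poly_Mapping.lookup m k = Poly_Mapping.lookup 0 k"
      using lookup[of "inv \<pi> k"] that by (simp add: \<pi>)
  qed
  then show ?thesis
    using \<open>inj \<pi>\<close> by auto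
qed

lemma Sym_one: "1 \<in> Sym"
  by (auto simp: Sym_def symmetric_def bounded_degree_def one_series.rep_eq map_key_eq_zero_iff)

lemma Sym_add:
  assumes "f \<in> Sym" "g \<in> Sym"
  shows "f + g \<in> Sym"
proof -
  obtain d e where "\<forall>m. coeff f m \<noteq> 0 \<longrightarrow> mdegree m \<le> d" "\<forall>m. coeff g m \<noteq> 0 \<longrightarrow> mdegree m \<le> e"
    using assms unfolding Sym_def bounded_degree_def by auto
  then have "mdegree m \<le> max d e" if "coeff (f + g) m \<noteq> 0" for m
    using that by (cases "coeff f m = 0") (auto simp: plus_series.rep_eq le_max_iff_disj)
  then have "bounded_degree (f + g)"
    unfolding bounded_degree_def by blast
  then show ?thesis
    using assms by (simp add: Sym_def symmetric_def plus_series.rep_eq)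
qed

lemma Sym_uminus: "f \<in> Sym \<Longrightarrow> - f \<in> Sym"
  by (simp add: Sym_def symmetric_def bounded_degree_def uminus_series.rep_eq)

lemma Sym_mult:
  assumes "f \<in> Sym" "g \<in> Sym"
  shows "f * g \<in> Sym"
proof -
  obtain d e where de: "\<And>m. coeff f m \<noteq> 0 \<Longrightarrow> mdegree m \<le> d" "\<And>m. coeff g m \<noteq> 0 \<Longrightarrow> mdegree m \<le> e"
    using assms unfolding Sym_def bounded_degree_def by auto
  have "mdegree m \<le> d + e" if "coeff (f * g) m \<noteq> 0" for m
  proof -
    from that obtain a b where "(a, b) \<in> splits m" "coeff f a * coeff g b \<noteq> 0"
      by (auto simp: times_series.rep_eq elim!: sum.not_neutral_contains_not_neutral)
    then show ?thesis
      using de[of a] de[of b] by (auto simp: splits_def mdegree_add intro: add_mono)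
  qed
  then have "bounded_degree (f * g)"
    unfolding bounded_degree_def by blast
  moreover have "symmetric (f * g)"
    unfolding symmetric_def
  proof (intro allI impI)
    fix \<pi> :: "nat \<Rightarrow> nat" and m :: monomial
    assume \<pi>: "permutation \<pi>"
    then have inj: "inj \<pi>" "inj (inv \<pi>)" "\<pi> \<circ> inv \<pi> = id" "inv \<pi> \<circ> \<pi> = id"
      using permutation_bijective[OF \<pi>] by (auto simp: bij_def surj_imp_inj_inv surj_iff)
    have id: "Poly_Mapping.map_key \<pi> (Poly_Mapping.map_key (inv \<pi>) a) = a"
      "Poly_Mapping.map_key (inv \<pi>) (Poly_Mapping.map_key \<pi> a) = a" for a :: monomial
      using inj by (simp_all add: map_key_compose map_key_id id_def)
    have coeff: "coeff f (Poly_Mapping.map_key (inv \<pi>) a) = coeff f a"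
      "coeff g (Poly_Mapping.map_key (inv \<pi>) a) = coeff g a" for a
      using assms permutation_inverse[OF \<pi>] by (auto simp: Sym_def symmetric_def)
    have i: "(Poly_Mapping.map_key (inv \<pi>) a, Poly_Mapping.map_key (inv \<pi>) b) \<in> splits m"
      if "(a, b) \<in> splits (Poly_Mapping.map_key \<pi> m)" for a b
      using that arg_cong[of _ _ "Poly_Mapping.map_key (inv \<pi>)"]
      by (simp add: splits_def map_key_plus[OF inj(2), symmetric] id)
    have j: "(Poly_Mapping.map_key \<pi> a, Poly_Mapping.map_key \<pi> b) \<in> splits (Poly_Mapping.map_key \<pi> m)"
      if "(a, b) \<in> splits m" for a b
      using that map_key_plus[OF inj(1), of a b] by (simp add: splits_def)
    let ?i = "\<lambda>(a, b). (Poly_Mapping.map_key (inv \<pi>) a, Poly_Mapping.map_key (inv \<pi>) b)"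
    let ?j = "\<lambda>(a, b). (Poly_Mapping.map_key \<pi> a, Poly_Mapping.map_key \<pi> b)"
    show "coeff (f * g) (Poly_Mapping.map_key \<pi> m) = coeff (f * g) m"
      unfolding times_series.rep_eq
      by (rule sum.reindex_bij_witness[where i = ?j and j = ?i])
        (auto simp: id coeff intro: i j)
  qed
  ultimately show ?thesis
    by (simp add: Sym_def)
qed

definition partitions :: "nat list set" where
  "partitions = {la. sorted_wrt (\<ge>) la \<and> (\<forall>p\<in>set la. 0 < p)}"

text \<open>
  Boxes are pairs (row, column), both counted from 0, with rows numbered from top to bottom.
\<close>

definition diagram :: "nat list \<Rightarrow> (nat \<times> nat) set" where
  "diagram la = {(i, j). i < length la \<and> j < la ! i}"

text \<open>
  Fillings are extended by 0 outside the diagram, so that each filling of the boxes is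
  represented by exactly one function.
\<close>

definition rpps :: "nat list \<Rightarrow> (nat \<times> nat \<Rightarrow> nat) set" where
  "rpps la = {T.
     (\<forall>b. b \<notin> diagram la \<longrightarrow> T b = 0) \<and>
     (\<forall>b\<in>diagram la. 1 \<le> T b) \<and>
     (\<forall>i j j'. (i, j) \<in> diagram la \<and> (i, j') \<in> diagram la \<and> j \<le> j' \<longrightarrow> T (i, j) \<le> T (i, j')) \<and>
     (\<forall>i i' j. (i, j) \<in> diagram la \<and> (i', j) \<in> diagram la \<and> i \<le> i' \<longrightarrow> T (i, j) \<le> T (i', j))}"

definition columns_containing :: "nat list \<Rightarrow> (nat \<times> nat \<Rightarrow> nat) \<Rightarrow> nat \<Rightarrow> nat" where
  "columns_containing la T k = card {j. \<exists>i. (i, j) \<in> diagram la \<and> T (i, j) = k}"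

text \<open>
  \<open>x\<^sup>T = m\<close>: the exponent of $x_{k+1}$, stored at index \<open>k\<close>, is the number of columns
  containing the entry \<open>k + 1\<close>.
\<close>

definition has_weight :: "nat list \<Rightarrow> (nat \<times> nat \<Rightarrow> nat) \<Rightarrow> monomial \<Rightarrow> bool" where
  "has_weight la T m \<longleftrightarrow>
     (\<forall>k. Poly_Mapping.lookup m k = columns_containing la T (Suc k))"

definition dual_grothendieck :: "nat list \<Rightarrow> series" where
  "dual_grothendieck la = Series (\<lambda>m. int (card {T \<in> rpps la. has_weight la T m}))"

lemma finite_diagram: "finite (diagram la)"
proof (rule finite_subset)
  show "diagram la \<subseteq> (\<Union>i<length la. {i} \<times> {..<la ! i})"
    by (auto simp: diagram_def)
qed simp

lemma finite_columns: "finite {j. \<exists>i. (i, j) \<in> diagram la \<and> T (i, j) = k}"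
proof (rule finite_subset)
  show "{j. \<exists>i. (i, j) \<in> diagram la \<and> T (i, j) = k} \<subseteq> snd ` diagram la"
  proof
    fix j
    assume "j \<in> {j. \<exists>i. (i, j) \<in> diagram la \<and> T (i, j) = k}"
    then obtain i where "(i, j) \<in> diagram la"
      by blast
    then show "j \<in> snd ` diagram la"
      by (rule rev_image_eqI) simp
  qed
qed (simp add: finite_diagram)

text \<open>Each filling has a weight, and the coefficients of \<open>dual_grothendieck\<close> count finite sets.\<close>

lemma has_weight_ex1: "\<exists>!m. has_weight la T m"
proof -
  have "{k. columns_containing la T (Suc k) \<noteq> 0} \<subseteq> (\<lambda>b. T b - 1) ` diagram la"
  proof
    fix k
    assume "k \<in> {k. columns_containing la T (Suc k) \<noteq> 0}"
    then have "{j. \<exists>i. (i, j) \<in> diagram la \<and> T (i, j) = Suc k} \<noteq> {}"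
      unfolding columns_containing_def by (metis (mono_tags, lifting) card.empty mem_Collect_eq)
    then obtain i j where "(i, j) \<in> diagram la" "T (i, j) = Suc k"
      by blast
    then show "k \<in> (\<lambda>b. T b - 1) ` diagram la"
      by (intro image_eqI[of _ _ "(i, j)"]) auto
  qed
  then have "finite {k. columns_containing la T (Suc k) \<noteq> 0}"
    by (rule finite_surj[OF finite_diagram])
  then have "has_weight la T (Abs_poly_mapping (\<lambda>k. columns_containing la T (Suc k)))"
    by (simp add: has_weight_def)
  moreover have "m = m'" if "has_weight la T m" "has_weight la T m'" for m m'
    using that by (intro poly_mapping_eqI) (simp add: has_weight_def)
  ultimately show ?thesis
    by blast
qed

lemma rppsD:
  assumes "T \<in> rpps la"
  shows "b \<notin> diagram la \<Longrightarrow> T b = 0" "b \<in> diagram la \<Longrightarrow> 1 \<le> T b"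
proof -
  have "\<forall>b. b \<notin> diagram la \<longrightarrow> T b = 0"
    using assms unfolding rpps_def mem_Collect_eq by (elim conjE)
  moreover have "\<forall>b\<in>diagram la. 1 \<le> T b"
    using assms unfolding rpps_def mem_Collect_eq by (elim conjE)
  ultimately show "b \<notin> diagram la \<Longrightarrow> T b = 0" "b \<in> diagram la \<Longrightarrow> 1 \<le> T b"
    by blast+
qed

lemma finite_rpps_weight: "finite {T \<in> rpps la. has_weight la T m}"
proof (rule finite_subset)
  let ?V = "Suc ` Poly_Mapping.keys m"
  show "finite {T. \<forall>b. (b \<in> diagram la \<longrightarrow> T b \<in> ?V) \<and> (b \<notin> diagram la \<longrightarrow> T b = 0)}"
    by (rule finite_set_of_finite_funs) (auto simp: finite_diagram)
  have V: "T b \<in> ?V" if T: "T \<in> rpps la" "has_weight la T m" and b: "b \<in> diagram la" for T b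
  proof -
    have "1 \<le> T b"
      using T(1) b by (rule rppsD(2))
    then obtain k where k: "T b = Suc k"
      by (cases "T b") auto
    obtain i j where "b = (i, j)"
      by (cases b)
    then have "j \<in> {j. \<exists>i. (i, j) \<in> diagram la \<and> T (i, j) = Suc k}" (is "j \<in> ?J")
      using b k by blast
    then have "card ?J \<noteq> 0"
      unfolding card_0_eq[OF finite_columns] by (rule ex_in_conv[THEN iffD1, OF exI])
    then have "columns_containing la T (Suc k) \<noteq> 0"
      unfolding columns_containing_def .
    then show ?thesis
      using T(2) k by (simp add: has_weight_def in_keys_iff)
  qed
  show "{T \<in> rpps la. has_weight la T m} \<subseteq>
      {T. \<forall>b. (b \<in> diagram la \<longrightarrow> T b \<in> ?V) \<and> (b \<notin> diagram la \<longrightarrow> T b = 0)}"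
  proof (intro subsetI CollectI allI conjI impI)
    fix T b
    assume "T \<in> {T \<in> rpps la. has_weight la T m}"
    then have T: "T \<in> rpps la" "has_weight la T m"
      by simp_all
    show "T b \<in> ?V" if "b \<in> diagram la"
      by (rule V[OF T that])
    show "T b = 0" if "b \<notin> diagram la"
      by (rule rppsD(1)[OF T(1) that])
  qed
qed

definition MSym :: "series set" where
  "MSym = Zmod.span (dual_grothendieck ` partitions)"

definition is_Z_basis :: "('a \<Rightarrow> series) \<Rightarrow> 'a set \<Rightarrow> series set \<Rightarrow> bool" where
  "is_Z_basis b I M \<longleftrightarrow>
     inj_on b I \<and> \<not> Zmod.dependent (b ` I) \<and> Zmod.span (b ` I) = M"

definition Z_module_iso :: "(series \<Rightarrow> series) \<Rightarrow> series set \<Rightarrow> series set \<Rightarrow> bool" where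
  "Z_module_iso \<phi> M N \<longleftrightarrow>
     bij_betw \<phi> M N \<and>
     (\<forall>f\<in>M. \<forall>g\<in>M. \<phi> (f + g) = \<phi> f + \<phi> g) \<and>
     (\<forall>c::int. \<forall>f\<in>M. \<phi> (of_int c * f) = of_int c * \<phi> f)"

end

theory Submission
  imports "HOL-Computational_Algebra.Polynomial" Defs
begin

text \<open>
  Recording, for every \<open>v\<close> and every column, how many of its entries are at most \<open>v\<close> turns a reverse
  plane partition into a chain of weakly decreasing height sequences. The exponents of two
  consecutive variables depend on a single member \<open>g\<close> of the chain, squeezed between its
  neighbours \<open>l\<close> and \<open>u\<close>: they count the columns with \<open>l < g\<close> and those with \<open>g < u\<close>. The generating
  function of all such \<open>g\<close> is symmetric in its two variables, by induction on the number of columns;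
  hence $g_\lambda$ is symmetric.

  A column of length \<open>h\<close> contains at most \<open>min K h\<close> different entries not exceeding \<open>K\<close>. So every
  exponent vector of $g_\lambda$ is dominated by \<open>\<lambda>\<close>, where the two sizes may differ, and \<open>\<lambda>\<close> itself
  occurs only for the filling with \<open>i\<close> in row \<open>i\<close>. The $g_\lambda$ are therefore unitriangular with
  respect to the monomial symmetric functions.
\<close>

subsection \<open>Sequences between two bounds\<close>

text \<open>The cap \<open>M\<close> on the first value serves the induction on columns: once
  \<open>g 0 = m\<close> is fixed, antitonicity caps the tail by \<open>m\<close>.\<close>

definition cuts :: "(nat \<Rightarrow> nat) \<Rightarrow> (nat \<Rightarrow> nat) \<Rightarrow> nat \<Rightarrow> (nat \<Rightarrow> nat) set" where
  "cuts l u M = {g. antimono g \<and> l \<le> g \<and> g \<le> u \<and> g 0 \<le> M}"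

text \<open>Taken over any commutative ring, so that the recursion is plain algebra;
  \<open>x\<close> and \<open>y\<close> later become independent polynomial variables.\<close>

definition cut_gf :: "'a::comm_ring_1 \<Rightarrow> 'a \<Rightarrow> (nat \<Rightarrow> nat) \<Rightarrow> (nat \<Rightarrow> nat) \<Rightarrow> nat \<Rightarrow> 'a" where
  "cut_gf x y l u M = (\<Sum>g\<in>cuts l u M. x ^ card {j. l j < g j} * y ^ card {j. g j < u j})"

lemma all_nat_iff: "(\<forall>n. P n) \<longleftrightarrow> P 0 \<and> (\<forall>n. P (Suc n))"
  by (metis not0_implies_Suc)

lemma antimono_case_nat_iff:
  "antimono (case_nat m g :: nat \<Rightarrow> nat) \<longleftrightarrow> antimono g \<and> g 0 \<le> m"
proof -
  have "(\<forall>n. case_nat m g (Suc n) \<le> case_nat m g n) \<longleftrightarrow> (\<forall>n. g (Suc n) \<le> g n) \<and> g 0 \<le> m"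
    by (subst all_nat_iff) auto
  then show ?thesis
    by (simp add: antimono_iff_le_Suc)
qed

lemma case_nat_shift: "case_nat (g 0) (g \<circ> Suc) = g"
  by (auto simp: fun_eq_iff split: nat.split)

lemma le_case_nat_iff: "l \<le> case_nat m g \<longleftrightarrow> l 0 \<le> m \<and> l \<circ> Suc \<le> g" for l :: "nat \<Rightarrow> nat"
  by (auto simp: le_fun_def split: nat.split)

lemma case_nat_le_iff: "case_nat m g \<le> u \<longleftrightarrow> m \<le> u 0 \<and> g \<le> u \<circ> Suc" for u :: "nat \<Rightarrow> nat"
  by (auto simp: le_fun_def split: nat.split)

lemma cuts_step: "cuts l u M = (\<Union>m\<in>{l 0..min (u 0) M}. case_nat m ` cuts (l \<circ> Suc) (u \<circ> Suc) m)"
proof (intro set_eqI iffI)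
  fix g
  assume "g \<in> cuts l u M"
  then have "case_nat (g 0) (g \<circ> Suc) \<in> cuts l u M"
    by (simp only: case_nat_shift)
  then have "g 0 \<in> {l 0..min (u 0) M}" "g \<circ> Suc \<in> cuts (l \<circ> Suc) (u \<circ> Suc) (g 0)"
    by (auto simp: cuts_def antimono_case_nat_iff le_case_nat_iff case_nat_le_iff)
  then show "g \<in> (\<Union>m\<in>{l 0..min (u 0) M}. case_nat m ` cuts (l \<circ> Suc) (u \<circ> Suc) m)"
    by (metis (no_types, lifting) UN_I case_nat_shift imageI)
qed (auto simp: cuts_def antimono_case_nat_iff le_case_nat_iff case_nat_le_iff)

lemma cuts_zero:
  assumes "\<And>j. u j = 0" "l \<le> u"
  shows "cuts l u M = {\<lambda>_. 0}"
  using assms by (auto simp: cuts_def le_fun_def antimono_def)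

lemma finite_cuts:
  assumes "\<forall>j\<ge>n. u j = 0"
  shows "finite (cuts l u M)"
proof (rule finite_subset)
  let ?A = "{..<n}"
  show "cuts l u M \<subseteq> {g. \<forall>j. (j \<in> ?A \<longrightarrow> g j \<in> {..M}) \<and> (j \<notin> ?A \<longrightarrow> g j = 0)}"
  proof
    fix g assume g: "g \<in> cuts l u M"
    have "g j \<le> M" for j
      using g antimonoD[of g 0 j] by (auto simp: cuts_def)
    moreover have "g j = 0" if "n \<le> j" for j
      using g le_funD[of g u j] assms that by (auto simp: cuts_def)
    ultimately show "g \<in> {g. \<forall>j. (j \<in> ?A \<longrightarrow> g j \<in> {..M}) \<and> (j \<notin> ?A \<longrightarrow> g j = 0)}"
      by auto
  qed
  show "finite {g. \<forall>j. (j \<in> ?A \<longrightarrow> g j \<in> {..M}) \<and> (j \<notin> ?A \<longrightarrow> g j = (0::nat))}"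
    by (rule finite_set_of_finite_funs) auto
qed

lemma card_nat_step:
  assumes "finite {j. P (Suc j)}"
  shows "card {j::nat. P j} = (if P 0 then 1 else 0) + card {j. P (Suc j)}"
proof -
  have *: "{j. P j} = (if P 0 then {0} else {}) \<union> Suc ` {j. P (Suc j)}"
    by (auto simp: image_iff) (metis not0_implies_Suc)+
  show ?thesis
    unfolding * using assms by (subst card_Un_disjoint) (auto simp: card_image)
qed

lemma disjoint_case_nat: "m \<noteq> m' \<Longrightarrow> case_nat m ` A \<inter> case_nat m' ` B = {}"
  by (auto dest: fun_cong[where x = 0])

lemma inj_case_nat: "inj_on (case_nat m) A"
  by (auto simp: inj_on_def fun_eq_iff split: nat.split_asm)

text \<open>Group by \<open>m = g 0\<close> as in \<open>cuts_step\<close>: the first column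
  contributes the factors for its own strict inequalities, and the tail is a cut of the shifted
  bounds with cap \<open>m\<close>.\<close>

lemma cut_gf_step:
  assumes fin: "\<forall>j\<ge>n. u j = 0"
  shows "cut_gf x y l u M =
    (\<Sum>m=l 0..min (u 0) M. (if l 0 < m then x else 1) * (if m < u 0 then y else 1) *
       cut_gf x y (l \<circ> Suc) (u \<circ> Suc) m)"
proof -
  let ?w = "\<lambda>g. x ^ card {j. l j < g j} * y ^ card {j. g j < u j}"
  have fin': "\<forall>j\<ge>n. (u \<circ> Suc) j = 0"
    using fin by simp
  have "cut_gf x y l u M =
      (\<Sum>m=l 0..min (u 0) M. sum ?w (case_nat m ` cuts (l \<circ> Suc) (u \<circ> Suc) m))"
    unfolding cut_gf_def
    by (subst cuts_step, intro sum.UNION_disjoint ballI impI disjoint_case_nat finite_imageI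
        finite_cuts[OF fin']) auto
  also have "\<dots> = (\<Sum>m=l 0..min (u 0) M. \<Sum>g\<in>cuts (l \<circ> Suc) (u \<circ> Suc) m. ?w (case_nat m g))"
    by (intro sum.cong refl sum.reindex[unfolded comp_def] inj_case_nat)
  also have "\<dots> = (\<Sum>m=l 0..min (u 0) M. (if l 0 < m then x else 1) * (if m < u 0 then y else 1) *
       cut_gf x y (l \<circ> Suc) (u \<circ> Suc) m)"
    unfolding cut_gf_def sum_distrib_left
  proof (intro sum.cong refl)
    fix m g
    assume "g \<in> cuts (l \<circ> Suc) (u \<circ> Suc) m"
    then have g: "g j \<le> u (Suc j)" for j
      by (auto simp: cuts_def le_fun_def)
    \<comment> \<open>Positive values of \<open>u\<close> occur only before \<open>n\<close>, so
      both counted sets are finite and \<open>card_nat_step\<close> applies.\<close>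
    have pos: "j < n" if "0 < u (Suc j)" for j
      using fin that by (metis Suc_leI less_irrefl not_less le_SucI)
    have sub: "{j. l (Suc j) < g j} \<subseteq> {..<n}" "{j. g j < u (Suc j)} \<subseteq> {..<n}"
      using g by (auto intro!: pos elim: order.strict_trans1[OF le0, THEN less_le_trans])
    show "?w (case_nat m g) = (if l 0 < m then x else 1) * (if m < u 0 then y else 1) *
        (x ^ card {j. (l \<circ> Suc) j < g j} * y ^ card {j. g j < (u \<circ> Suc) j})"
      using card_nat_step[of "\<lambda>j. l j < case_nat m g j"] card_nat_step[of "\<lambda>j. case_nat m g j < u j"]
        finite_subset[OF sub(1)] finite_subset[OF sub(2)] by simp
  qed
  finally show ?thesis .
qed

lemma cut_gf_stable: "u 0 \<le> M \<Longrightarrow> cut_gf x y l u M = cut_gf x y l u (u 0)"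
proof -
  assume "u 0 \<le> M"
  then have "cuts l u M = cuts l u (u 0)"
    by (auto simp: cuts_def le_fun_def)
  then show ?thesis
    by (simp add: cut_gf_def)
qed

text \<open>
  \<open>x * gap_gf x y l u m\<close> is the part of \<open>cut_gf\<close> lost by the restriction \<open>g 0 \<le> m\<close>. It is not symmetric
  in \<open>x\<close> and \<open>y\<close>, but its combination with its own tail sum in the induction below is.
\<close>

definition gap_gf :: "'a::comm_ring_1 \<Rightarrow> 'a \<Rightarrow> (nat \<Rightarrow> nat) \<Rightarrow> (nat \<Rightarrow> nat) \<Rightarrow> nat \<Rightarrow> 'a" where
  "gap_gf x y l u m = (if m < u 0 then cut_gf x y (l \<circ> Suc) (u \<circ> Suc) (u 0) +
     y * (\<Sum>m'\<in>{m<..<u 0}. cut_gf x y (l \<circ> Suc) (u \<circ> Suc) m') else 0)"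

text \<open>The sequences lost under the cap have \<open>g 0 > m \<ge> l 0\<close>, so each carries
  the factor \<open>x\<close>; among them only those with \<open>g 0 = u 0\<close> lack the factor
  \<open>y\<close> from the first column.\<close>

lemma cut_gf_eq_gap:
  assumes fin: "\<forall>j\<ge>n. u j = 0" and "l 0 \<le> m"
  shows "cut_gf x y l u m = cut_gf x y l u (u 0) - x * gap_gf x y l u m"
proof (cases "m < u 0")
  case True
  let ?f = "\<lambda>m. (if l 0 < m then x else 1) * (if m < u 0 then y else 1) *
       cut_gf x y (l \<circ> Suc) (u \<circ> Suc) m"
  have "{l 0..u 0} = {l 0..m} \<union> insert (u 0) {m<..<u 0}"
    using True assms by auto
  then have "cut_gf x y l u (u 0) = sum ?f ({l 0..m} \<union> insert (u 0) {m<..<u 0})"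
    by (simp add: cut_gf_step[OF fin])
  also have "\<dots> = sum ?f {l 0..m} + (?f (u 0) + sum ?f {m<..<u 0})"
    using True by (subst sum.union_disjoint) auto
  also have "sum ?f {l 0..m} = cut_gf x y l u m"
    using True by (simp add: cut_gf_step[OF fin, where x = x and y = y and l = l and M = m] min_def)
  also have "sum ?f {m<..<u 0} = x * (y * (\<Sum>m'\<in>{m<..<u 0}. cut_gf x y (l \<circ> Suc) (u \<circ> Suc) m'))"
    unfolding sum_distrib_left using assms(2) by (intro sum.cong) auto
  finally show ?thesis
    using True assms by (simp add: gap_gf_def comp_def algebra_simps)
qed (use cut_gf_stable[of u m x y l] in \<open>simp add: gap_gf_def\<close>)

text \<open>Both claims go through one induction on the number of columns. Each quantity for
  \<open>l\<close>, \<open>u\<close> becomes a symmetric polynomial in \<open>x\<close> and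
  \<open>y\<close> times the full generating function of the tail, minus \<open>x * y\<close> times
  values of the second quantity for the tail.\<close>

lemma cut_gf_symmetric_aux:
  fixes l u :: "nat \<Rightarrow> nat"
  assumes "antimono l" "antimono u" "l \<le> u" "\<forall>j\<ge>n. u j = 0"
  shows "cut_gf x y l u (u 0) = cut_gf y x l u (u 0) \<and>
    (\<forall>m\<ge>l 0. gap_gf x y l u m + x * (\<Sum>m'\<in>{m<..<u 0}. gap_gf x y l u m') =
             gap_gf y x l u m + y * (\<Sum>m'\<in>{m<..<u 0}. gap_gf y x l u m'))"
  using assms
proof (induction n arbitrary: l u)
  case 0
  then show ?case
    using cuts_zero[of "\<lambda>_. 0" "\<lambda>_. 0" 0] by (simp add: cut_gf_def gap_gf_def le_fun_def)
next
  case (Suc n)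
  define l' u' N where "l' = l \<circ> Suc" and "u' = u \<circ> Suc" and "N = u 0"
  define E where "E = (\<lambda>x y m. gap_gf x y l' u' m +
    x * (\<Sum>m'\<in>{m<..<u' 0}. gap_gf x y l' u' m') :: 'a)"
  have fin': "\<forall>j\<ge>n. u' j = 0"
    using Suc.prems(4) by (simp add: u'_def)
  have prems: "antimono l'" "antimono u'" "l' \<le> u'"
    using Suc.prems by (auto simp: l'_def u'_def antimono_def le_fun_def)
  have IH: "cut_gf x y l' u' (u' 0) = cut_gf y x l' u' (u' 0)" "\<And>m. l' 0 \<le> m \<Longrightarrow> E x y m = E y x m"
    using Suc.IH[OF prems fin'] unfolding E_def by blast+
  have le: "l' 0 \<le> l 0" "u' 0 \<le> N" "l 0 \<le> N"
    using Suc.prems(1-3) by (auto simp: l'_def u'_def N_def antimono_def le_fun_def)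
  have P': "cut_gf x y l' u' N = cut_gf y x l' u' N"
    using IH(1) le(2) by (simp add: cut_gf_stable[of u' N])
  have gap0: "gap_gf x y l' u' m = 0" if "u' 0 \<le> m" for m and x y :: 'a
    using that by (simp add: gap_gf_def)
  \<comment> \<open>Raising the limit of the sum from \<open>u' 0\<close> to \<open>N\<close> adds
    only vanishing terms, and gives the tail the same summation range as the whole.\<close>
  have E: "E x y m = gap_gf x y l' u' m + x * (\<Sum>m'\<in>{m<..<N}. gap_gf x y l' u' m')" for x y m
  proof -
    have "(\<Sum>m'\<in>{m<..<u' 0}. gap_gf x y l' u' m') = (\<Sum>m'\<in>{m<..<N}. gap_gf x y l' u' m')"
      using le(2) by (intro sum.mono_neutral_left) (auto simp: gap0)
    then show ?thesis
      by (simp add: E_def)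
  qed
  have cut: "cut_gf x y l' u' m = cut_gf x y l' u' N - x * gap_gf x y l' u' m"
    if "l 0 \<le> m" for m and x y :: 'a
    using cut_gf_eq_gap[OF fin', where x = x and y = y and l = l' and m = m] that le
      cut_gf_stable[of u' N x y l'] by simp
  have R: "(\<Sum>m'\<in>{m<..<N}. cut_gf x y l' u' m') =
      of_nat (card {m<..<N}) * cut_gf x y l' u' N - x * (\<Sum>m'\<in>{m<..<N}. gap_gf x y l' u' m')"
    if "l 0 \<le> m" for m and x y :: 'a
  proof -
    have "(\<Sum>m'\<in>{m<..<N}. cut_gf x y l' u' m') =
        (\<Sum>m'\<in>{m<..<N}. cut_gf x y l' u' N - x * gap_gf x y l' u' m')"
      using that by (intro sum.cong refl cut) auto
    then show ?thesis
      by (simp add: sum_subtractf sum_distrib_left)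
  qed
  have gap: "gap_gf x y l u m = cut_gf x y l' u' N + y * (of_nat (card {m<..<N}) * cut_gf x y l' u' N
       - x * (\<Sum>m'\<in>{m<..<N}. gap_gf x y l' u' m'))" if "l 0 \<le> m" "m < N" for m and x y :: 'a
    using that R[of m x y] by (simp add: gap_gf_def l'_def u'_def N_def)
  \<comment> \<open>The single sum of tail gaps comes from the first summand, the double sum from
    the second; together they are exactly the sum of \<open>E x y m'\<close>.\<close>
  have new_E: "gap_gf x y l u m + x * (\<Sum>m'\<in>{m<..<N}. gap_gf x y l u m') =
      (1 + (x + y) * of_nat (card {m<..<N}) + x * y * (\<Sum>m'\<in>{m<..<N}. of_nat (card {m'<..<N})))
        * cut_gf x y l' u' N - x * y * (\<Sum>m'\<in>{m<..<N}. E x y m')"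
    if m: "l 0 \<le> m" "m < N" for m and x y :: 'a
  proof -
    have "(\<Sum>m'\<in>{m<..<N}. gap_gf x y l u m') = (\<Sum>m'\<in>{m<..<N}. cut_gf x y l' u' N +
        y * (of_nat (card {m'<..<N}) * cut_gf x y l' u' N
         - x * (\<Sum>m'\<in>{m'<..<N}. gap_gf x y l' u' m')))"
      using m by (intro sum.cong refl gap) auto
    then show ?thesis
      using m unfolding E
      by (simp add: gap sum.distrib sum_subtractf sum_distrib_left[symmetric] sum_distrib_right[symmetric]
          algebra_simps del: card_greaterThanLessThan)
  qed
  have "cut_gf x y l u N = cut_gf y x l u N"
  proof (cases "l 0 < N")
    case True
    \<comment> \<open>In the recursion the value \<open>l 0\<close> has weight \<open>y\<close>, the
      value \<open>N\<close> has weight \<open>x\<close>, and every value in between has weight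
      \<open>x * y\<close>.\<close>
    have new_P: "cut_gf x y l u N = (x + y + x * y * of_nat (card {l 0<..<N})) * cut_gf x y l' u' N
        - x * y * E x y (l 0)" for x y :: 'a
    proof -
      let ?f = "\<lambda>m. (if l 0 < m then x else 1) * (if m < u 0 then y else 1) *
        cut_gf x y (l \<circ> Suc) (u \<circ> Suc) m"
      have "cut_gf x y l u N = sum ?f {l 0..N}"
        using cut_gf_step[OF Suc.prems(4), where x = x and y = y and l = l and M = N] by (simp add: N_def)
      also have "{l 0..N} = insert (l 0) (insert N {l 0<..<N})"
        using True by auto
      also have "sum ?f \<dots> = ?f (l 0) + ?f N + sum ?f {l 0<..<N}"
        using True by (simp add: N_def)
      also have "sum ?f {l 0<..<N} = x * y * (\<Sum>m'\<in>{l 0<..<N}. cut_gf x y l' u' m')"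
        unfolding sum_distrib_left by (intro sum.cong) (auto simp: N_def l'_def u'_def)
      finally show ?thesis
        using True cut[of "l 0" x y] R[of "l 0" x y] E[of x y "l 0"]
        by (simp add: l'_def[symmetric] u'_def[symmetric] N_def[symmetric] algebra_simps)
    qed
    show ?thesis
      unfolding new_P P' IH(2)[OF le(1)] by (simp add: algebra_simps)
  next
    \<comment> \<open>Here \<open>l 0 = N\<close>: the first value is forced and contributes the
      factor 1.\<close>
    case False
    then show ?thesis
      using le P' cut_gf_step[OF Suc.prems(4), where x = x and y = y and l = l and M = N]
        cut_gf_step[OF Suc.prems(4), where x = y and y = x and l = l and M = N]
      by (simp add: N_def l'_def u'_def)
  qed
  moreover have "gap_gf x y l u m + x * (\<Sum>m'\<in>{m<..<N}. gap_gf x y l u m') =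
      gap_gf y x l u m + y * (\<Sum>m'\<in>{m<..<N}. gap_gf y x l u m')" if "l 0 \<le> m" for m
  proof (cases "m < N")
    case True
    have "(\<Sum>m'\<in>{m<..<N}. E x y m') = (\<Sum>m'\<in>{m<..<N}. E y x m')"
      using that le by (intro sum.cong refl IH(2)) auto
    then show ?thesis
      unfolding new_E[OF that True] P' by (simp add: algebra_simps)
  qed (simp add: gap_gf_def N_def)
  ultimately show ?case
    by (simp add: N_def)
qed

text \<open>Compare coefficients in the symmetry of \<open>cut_gf\<close>, with the cap
  \<open>u 0\<close> that \<open>g \<le> u\<close> already implies.\<close>

lemma card_cuts_symmetric:
  fixes l u :: "nat \<Rightarrow> nat"
  assumes "antimono l" "antimono u" "l \<le> u" "\<forall>j\<ge>n. u j = 0"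
  shows "card {g. antimono g \<and> l \<le> g \<and> g \<le> u \<and> card {j. l j < g j} = a \<and> card {j. g j < u j} = b} =
    card {g. antimono g \<and> l \<le> g \<and> g \<le> u \<and> card {j. l j < g j} = b \<and> card {j. g j < u j} = a}"
proof -
  \<comment> \<open>\<open>X\<close> is the outer variable and \<open>Y\<close> the inner one,
    embedded as a constant, so iterated \<open>poly.coeff\<close> reads off the exponent of
    \<open>X\<close> first and then that of \<open>Y\<close>.\<close>
  define X Y :: "int poly poly" where "X = monom 1 1" and "Y = [:monom 1 1:]"
  let ?a = "\<lambda>g. card {j. l j < g j}" and ?b = "\<lambda>g. card {j. g j < u j}"
  have C: "{g. antimono g \<and> l \<le> g \<and> g \<le> u \<and> ?a g = a \<and> ?b g = b} =
      {g \<in> cuts l u (u 0). ?a g = a \<and> ?b g = b}" for a b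
    by (auto simp: cuts_def le_fun_def)
  have monom: "X ^ i * Y ^ j = monom (monom 1 j) i" "Y ^ j * X ^ i = monom (monom 1 j) i" for i j
    by (simp_all add: X_def Y_def poly_const_pow smult_monom monom_power mult.commute[of "_ ^ j"])
  have coeff: "poly.coeff (poly.coeff (\<Sum>g\<in>A. monom (monom 1 (q g)) (p g)) a) b =
      int (card {g \<in> A. p g = a \<and> q g = b})"
    if "finite A" for A :: "(nat \<Rightarrow> nat) set" and p q a b
    using that by (simp add: Polynomial.coeff_sum if_distrib[of "\<lambda>p. poly.coeff p b"]
        sum.inter_filter[symmetric] conj_ac cong: if_cong conj_cong)
  note fin = finite_cuts[OF assms(4), where l = l and M = "u 0"]
  have 1: "poly.coeff (poly.coeff (cut_gf X Y l u (u 0)) a) b =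
      int (card {g \<in> cuts l u (u 0). ?a g = a \<and> ?b g = b})"
    by (simp add: cut_gf_def monom coeff[OF fin])
  have 2: "poly.coeff (poly.coeff (cut_gf Y X l u (u 0)) a) b =
      int (card {g \<in> cuts l u (u 0). ?a g = b \<and> ?b g = a})"
    by (simp add: cut_gf_def monom coeff[OF fin] conj_commute)
  have "cut_gf X Y l u (u 0) = cut_gf Y X l u (u 0)"
    using cut_gf_symmetric_aux[OF assms] by blast
  then show ?thesis
    unfolding C using 1 2 by simp
qed

subsection \<open>Height functions and symmetry\<close>

lemma diagram_downward:
  assumes "la \<in> partitions" "(i, j) \<in> diagram la" "i' \<le> i" "j' \<le> j"
  shows "(i', j') \<in> diagram la"
proof -
  have "la ! i \<le> la ! i'"
    using assms sorted_wrt_nth_less[of "(\<ge>)" la i' i]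
    by (cases "i' = i") (auto simp: partitions_def diagram_def)
  then show ?thesis
    using assms by (auto simp: diagram_def)
qed

lemma downward_closed_eq_lessThan:
  fixes S :: "nat set"
  assumes "finite S" "\<And>i i'. i \<in> S \<Longrightarrow> i' \<le> i \<Longrightarrow> i' \<in> S"
  shows "S = {..<card S}"
proof (cases "S = {}")
  case False
  have "S = {..Max S}"
    using assms False by (auto intro: Max_in)
  then show ?thesis
    by (metis card_atMost lessThan_Suc_atMost)
qed simp

lemma finite_diagram_column: "finite {i. (i, j) \<in> diagram la \<and> P i}"
  by (rule finite_subset[of _ "{..<length la}"]) (auto simp: diagram_def)

definition column_length :: "nat list \<Rightarrow> nat \<Rightarrow> nat" where
  "column_length la j = card {i. (i, j) \<in> diagram la}"

lemma less_column_length_iff: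
  assumes "la \<in> partitions"
  shows "i < column_length la j \<longleftrightarrow> (i, j) \<in> diagram la"
proof -
  have "{i. (i, j) \<in> diagram la} = {..<column_length la j}"
    unfolding column_length_def using finite_diagram_column[of j la "\<lambda>_. True"]
    by (intro downward_closed_eq_lessThan) (auto intro: diagram_downward[OF assms])
  then show ?thesis
    by auto
qed

text \<open>A crude bound on the number of columns, which also covers the empty partition.\<close>

lemma column_length_eq_0:
  assumes "sum_list la \<le> j"
  shows "column_length la j = 0"
proof -
  have "la ! i \<le> j" if "i < length la" for i
    using assms elem_le_sum_list[OF that] by simp
  then have "{i. (i, j) \<in> diagram la} = {}"
    by (force simp: diagram_def)
  then show ?thesis
    by (simp add: column_length_def)
qed

section \<open>Reverse plane partitions as chains of column heights\<close>

definition height :: "nat list \<Rightarrow> (nat \<times> nat \<Rightarrow> nat) \<Rightarrow> nat \<Rightarrow> nat \<Rightarrow> nat" where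
  "height la T v j = card {i. (i, j) \<in> diagram la \<and> T (i, j) \<le> v}"

lemma rpps_mono:
  assumes "T \<in> rpps la"
  shows "\<lbrakk>(i, j) \<in> diagram la; (i, j') \<in> diagram la; j \<le> j'\<rbrakk> \<Longrightarrow> T (i, j) \<le> T (i, j')"
    and "\<lbrakk>(i, j) \<in> diagram la; (i', j) \<in> diagram la; i \<le> i'\<rbrakk> \<Longrightarrow> T (i, j) \<le> T (i', j)"
  using assms unfolding rpps_def by blast+

text \<open>Columns increase weakly, so the entries at most \<open>v\<close> fill an initial segment
  of each column and their number determines the segment.\<close>

lemma less_height_iff:
  assumes la: "la \<in> partitions" and T: "T \<in> rpps la"
  shows "i < height la T v j \<longleftrightarrow> (i, j) \<in> diagram la \<and> T (i, j) \<le> v"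
proof -
  have "{i. (i, j) \<in> diagram la \<and> T (i, j) \<le> v} = {..<height la T v j}"
    unfolding height_def
  proof (rule downward_closed_eq_lessThan[OF finite_diagram_column])
    fix i i'
    assume "i \<in> {i. (i, j) \<in> diagram la \<and> T (i, j) \<le> v}" "i' \<le> i"
    then show "i' \<in> {i. (i, j) \<in> diagram la \<and> T (i, j) \<le> v}"
      using diagram_downward[OF la, of i j i' j] rpps_mono(2)[OF T, of i' j i] by auto
  qed
  then show ?thesis
    by auto
qed

text \<open>In column \<open>j\<close> the entries equal to \<open>Suc v\<close> occupy the rows
  from \<open>height la T v j\<close> up to, but excluding,
  \<open>height la T (Suc v) j\<close>.\<close>

lemma columns_containing_eq_height:
  assumes la: "la \<in> partitions" and T: "T \<in> rpps la"
  shows "columns_containing la T (Suc v) = card {j. height la T v j < height la T (Suc v) j}"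
proof -
  have "(\<exists>i. (i, j) \<in> diagram la \<and> T (i, j) = Suc v) \<longleftrightarrow> height la T v j < height la T (Suc v) j"
    for j
  proof -
    have "(i, j) \<in> diagram la \<and> T (i, j) = Suc v \<longleftrightarrow>
        i < height la T (Suc v) j \<and> \<not> i < height la T v j" for i
      using less_height_iff[OF la T] by auto
    then have "(\<exists>i. (i, j) \<in> diagram la \<and> T (i, j) = Suc v) \<longleftrightarrow>
        (\<exists>i. i < height la T (Suc v) j \<and> \<not> i < height la T v j)"
      by (simp only:)
    also have "\<dots> \<longleftrightarrow> height la T v j < height la T (Suc v) j"
      by (meson le_less_trans not_less order_refl)
    finally show ?thesis .
  qed
  then show ?thesis
    by (simp add: columns_containing_def)
qed

text \<open>The image of \<open>height la\<close>: starting at 0 says that entries are positive,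
  antitonicity in \<open>j\<close> that rows increase, and the eventual value that every box is
  filled. Increase down the columns is built into the use of heights.\<close>

definition height_functions :: "nat list \<Rightarrow> (nat \<Rightarrow> nat \<Rightarrow> nat) set" where
  "height_functions la = {h. (\<forall>j. h 0 j = 0) \<and> (\<forall>v. h v \<le> h (Suc v)) \<and> (\<forall>v. antimono (h v)) \<and>
     (\<exists>N. \<forall>v\<ge>N. h v = column_length la)}"

lemma height_functions_mono:
  "h \<in> height_functions la \<Longrightarrow> v \<le> w \<Longrightarrow> h v \<le> h w"
  by (rule lift_Suc_mono_le[of h]) (auto simp: height_functions_def)

lemma height_functions_le_column_length:
  assumes "h \<in> height_functions la"
  shows "h v \<le> column_length la"
proof -
  obtain N where "\<forall>w\<ge>N. h w = column_length la"
    using assms by (auto simp: height_functions_def)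
  then show ?thesis
    using height_functions_mono[OF assms, of v "max v N"] by simp
qed

lemma less_column_length_imp_less_height:
  assumes "h \<in> height_functions la" "i < column_length la j"
  shows "\<exists>v. i < h v j"
proof -
  obtain N where "\<forall>w\<ge>N. h w = column_length la"
    using assms by (auto simp: height_functions_def)
  then show ?thesis
    using assms(2) by (intro exI[of _ N]) simp
qed

lemma height_in_height_functions:
  assumes la: "la \<in> partitions" and T: "T \<in> rpps la"
  shows "height la T \<in> height_functions la"
  unfolding height_functions_def
proof (intro CollectI conjI allI)
  \<comment> \<open>Heights are compared by comparing the initial segments that they count.\<close>
  have le: "height la T v j \<le> height la T v' j'"
    if "\<And>i. i < height la T v j \<Longrightarrow> i < height la T v' j'" for v v' j j'
    using that[of "height la T v' j'"] by (meson linorder_not_less order_less_irrefl)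
  show "height la T 0 j = 0" for j
    using less_height_iff[OF la T, of 0 0 j] rppsD(2)[OF T, of "(0, j)"] by auto
  show "height la T v \<le> height la T (Suc v)" for v
    by (auto intro!: le_funI le simp: less_height_iff[OF la T])
  show "antimono (height la T v)" for v
  proof (intro antimonoI le)
    fix j j' i assume "j \<le> j'" "i < height la T v j'"
    then show "i < height la T v j"
      using diagram_downward[OF la, of i j' i j] rpps_mono(1)[OF T, of i j j']
      by (auto simp: less_height_iff[OF la T])
  qed
  \<comment> \<open>From the largest entry on, every box is counted. For an empty diagram
    \<open>Max\<close> is unspecified, but then both sides are 0.\<close>
  have "height la T v j = column_length la j" if "Max (T ` diagram la) \<le> v" for v j
  proof -
    have "T (i, j) \<le> v" if "(i, j) \<in> diagram la" for i
      using that \<open>Max (T ` diagram la) \<le> v\<close> finite_diagram[of la]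
      by (meson Max_ge finite_imageI image_eqI order_trans)
    then show ?thesis
      unfolding height_def column_length_def by (intro arg_cong[where f = card]) auto
  qed
  then show "\<exists>N. \<forall>v\<ge>N. height la T v = column_length la"
    by blast
qed

text \<open>The inverse of \<open>height la\<close>; the value 0 outside the diagram follows the
  convention of \<open>rpps\<close>.\<close>

definition filling_of_heights :: "nat list \<Rightarrow> (nat \<Rightarrow> nat \<Rightarrow> nat) \<Rightarrow> nat \<times> nat \<Rightarrow> nat" where
  "filling_of_heights la h = (\<lambda>(i, j). if (i, j) \<in> diagram la then LEAST v. i < h v j else 0)"

text \<open>The \<open>v\<close> with \<open>i < h v j\<close> form an upward closed set, nonempty
  because the heights reach the column length; so bounding its least element by \<open>v\<close>
  means that \<open>v\<close> belongs to it.\<close>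

lemma filling_of_heights_le_iff:
  assumes la: "la \<in> partitions" and h: "h \<in> height_functions la" and ij: "(i, j) \<in> diagram la"
  shows "filling_of_heights la h (i, j) \<le> v \<longleftrightarrow> i < h v j"
proof
  have ex: "\<exists>v. i < h v j"
    using less_column_length_imp_less_height[OF h] less_column_length_iff[OF la] ij by blast
  assume "filling_of_heights la h (i, j) \<le> v"
  then show "i < h v j"
    using LeastI_ex[OF ex] ij height_functions_mono[OF h, of "LEAST v. i < h v j" v]
    by (auto simp: filling_of_heights_def le_fun_def intro: less_le_trans)
qed (use ij in \<open>auto simp: filling_of_heights_def intro: Least_le\<close>)

lemma filling_of_heights_in_rpps:
  assumes la: "la \<in> partitions" and h: "h \<in> height_functions la"
  shows "filling_of_heights la h \<in> rpps la"
proof -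
  let ?T = "filling_of_heights la h"
  note le_iff = filling_of_heights_le_iff[OF la h]
  have "?T b = 0" if "b \<notin> diagram la" for b
    using that by (auto simp: filling_of_heights_def split: prod.split)
  moreover have "1 \<le> ?T b" if "b \<in> diagram la" for b
  proof (cases b)
    case (Pair i j)
    then show ?thesis
      using le_iff[of i j 0] that h by (auto simp: height_functions_def)
  qed
  moreover have "?T (i, j) \<le> ?T (i, j')"
    if "(i, j) \<in> diagram la" "(i, j') \<in> diagram la" "j \<le> j'" for i j j'
  proof -
    have "i < h (?T (i, j')) j'"
      using le_iff[OF that(2), of "?T (i, j')"] by simp
    also have "\<dots> \<le> h (?T (i, j')) j"
      using h that(3) by (auto simp: height_functions_def antimono_def)
    finally show ?thesis
      using le_iff[OF that(1)] by simp
  qed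
  moreover have "?T (i, j) \<le> ?T (i', j)"
    if "(i, j) \<in> diagram la" "(i', j) \<in> diagram la" "i \<le> i'" for i i' j
    using le_iff[OF that(2), of "?T (i', j)"] le_iff[OF that(1), of "?T (i', j)"] that(3) by simp
  ultimately show ?thesis
    unfolding rpps_def by blast
qed

lemma bij_betw_height:
  assumes la: "la \<in> partitions"
  shows "bij_betw (height la) (rpps la) (height_functions la)"
proof (rule bij_betw_byWitness[where f' = "filling_of_heights la"])
  show "\<forall>T\<in>rpps la. filling_of_heights la (height la T) = T"
  proof (intro ballI ext)
    fix T and b :: "nat \<times> nat" assume T: "T \<in> rpps la"
    obtain i j where b: "b = (i, j)"
      by (cases b)
    show "filling_of_heights la (height la T) b = T b"
    proof (cases "b \<in> diagram la")
      case True
      have "filling_of_heights la (height la T) b \<le> v \<longleftrightarrow> T b \<le> v" for v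
        using True filling_of_heights_le_iff[OF la height_in_height_functions[OF la T], of i j v]
        by (simp add: b less_height_iff[OF la T])
      then show ?thesis
        by (meson order_antisym order_refl)
    next
      case False
      then show ?thesis
        using rppsD(1)[OF T False] by (simp add: filling_of_heights_def b)
    qed
  qed
  show "\<forall>h\<in>height_functions la. height la (filling_of_heights la h) = h"
  proof (intro ballI ext)
    fix h v j assume h: "h \<in> height_functions la"
    have "(i, j) \<in> diagram la" if "i < h v j" for i
      using height_functions_le_column_length[OF h, of v] less_column_length_iff[OF la] that
      by (meson le_funD less_le_trans)
    then have "{i. (i, j) \<in> diagram la \<and> filling_of_heights la h (i, j) \<le> v} = {..<h v j}"
      using filling_of_heights_le_iff[OF la h] by auto
    then show "height la (filling_of_heights la h) v j = h v j"
      by (simp add: height_def)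
  qed
qed (auto simp: height_in_height_functions filling_of_heights_in_rpps la)

section \<open>Exchanging the exponents of two consecutive variables\<close>

definition weighted_heights :: "nat list \<Rightarrow> (nat \<Rightarrow> nat) \<Rightarrow> (nat \<Rightarrow> nat \<Rightarrow> nat) set" where
  "weighted_heights la e = {h \<in> height_functions la. \<forall>v. e v = card {j. h v j < h (Suc v) j}}"

lemma bij_betw_weighted_heights:
  assumes "la \<in> partitions"
  shows "bij_betw (height la) {T \<in> rpps la. has_weight la T m} (weighted_heights la (poly_mapping.lookup m))"
  unfolding weighted_heights_def
  by (rule bij_betw_Collect[OF bij_betw_height[OF assms]])
    (simp add: has_weight_def columns_containing_eq_height[OF assms])

lemma coeff_dual_grothendieck:
  "coeff (dual_grothendieck la) m = int (card {T \<in> rpps la. has_weight la T m})"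
  by (simp add: dual_grothendieck_def Series_inverse)

text \<open>Only the member \<open>g = h (Suc q)\<close> is free, and it meets nothing but its two
  neighbours and the exponents at \<open>q\<close> and \<open>Suc q\<close>. Since \<open>h0\<close>
  need not have these two exponents, one \<open>h0\<close> serves both orders of them.\<close>

lemma weighted_heights_fiber:
  assumes h0: "h0 \<in> height_functions la"
    and e: "\<And>v. v \<noteq> q \<Longrightarrow> v \<noteq> Suc q \<Longrightarrow> e v = card {j. h0 v j < h0 (Suc v) j}"
  shows "card {h \<in> weighted_heights la e. h(Suc q := k) = h0(Suc q := k)} =
    card {g. antimono g \<and> h0 q \<le> g \<and> g \<le> h0 (Suc (Suc q)) \<and>
      card {j. h0 q j < g j} = e q \<and> card {j. g j < h0 (Suc (Suc q)) j} = e (Suc q)}"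
    (is "card ?F = card ?G")
proof -
  have "?F = (\<lambda>g. h0(Suc q := g)) ` ?G"
  proof (intro equalityI subsetI)
    fix h assume h: "h \<in> ?F"
    then have eq: "h v = h0 v" if "v \<noteq> Suc q" for v
      using that by (auto dest: fun_cong[of _ _ v])
    then have "h = h0(Suc q := h (Suc q))"
      by auto
    moreover have "h (Suc q) \<in> ?G"
      using h eq[of q] eq[of "Suc (Suc q)"]
      by (simp add: weighted_heights_def height_functions_def) metis
    ultimately show "h \<in> (\<lambda>g. h0(Suc q := g)) ` ?G"
      by blast
  next
    fix h assume "h \<in> (\<lambda>g. h0(Suc q := g)) ` ?G"
    then obtain g where g: "g \<in> ?G" and h: "h = h0(Suc q := g)"
      by blast
    obtain N where "\<forall>v\<ge>N. h0 v = column_length la"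
      using h0 by (auto simp: height_functions_def)
    \<comment> \<open>The threshold is raised past the altered index \<open>Suc q\<close>.\<close>
    then have "\<forall>v\<ge>max N (Suc (Suc q)). h v = column_length la"
      by (auto simp: h)
    moreover have "h 0 j = 0" "h v \<le> h (Suc v)" "antimono (h v)" for v j
      using h0 g by (auto simp: h height_functions_def)
    ultimately have "h \<in> height_functions la"
      unfolding height_functions_def by blast
    moreover have "e v = card {j. h v j < h (Suc v) j}" for v
      using g e[of v] by (auto simp: h)
    ultimately show "h \<in> ?F"
      by (simp add: weighted_heights_def h)
  qed
  moreover have "inj_on (\<lambda>g. h0(Suc q := g)) ?G"
    by (auto simp: inj_on_def dest: fun_cong[of _ _ "Suc q"])
  ultimately show ?thesis
    by (simp add: card_image)
qed

lemma card_weighted_heights_swap: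
  assumes fin: "\<And>e. e = e1 \<or> e = e2 \<Longrightarrow> finite (weighted_heights la e)"
    and e: "e2 = e1 \<circ> transpose q (Suc q)"
  shows "card (weighted_heights la e1) = card (weighted_heights la e2)"
proof -
  \<comment> \<open>Overwriting the member at \<open>Suc q\<close> with a fixed value forgets it, so
    the fibers of \<open>r\<close> are those of \<open>weighted_heights_fiber\<close>.\<close>
  define r where "r = (\<lambda>h :: nat \<Rightarrow> nat \<Rightarrow> nat. h(Suc q := undefined))"
  \<comment> \<open>Taking both images makes the two sums run over one index set; corresponding
    fibers are equinumerous by \<open>card_cuts_symmetric\<close>.\<close>
  define R where "R = r ` (weighted_heights la e1 \<union> weighted_heights la e2)"
  have card: "card (weighted_heights la e) = (\<Sum>k\<in>R. card {h \<in> weighted_heights la e. r h = k})"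
    if "e = e1 \<or> e = e2" for e
    unfolding card_eq_sum using fin that
    by (intro sum.group[symmetric]) (auto simp: R_def)
  have "card {h \<in> weighted_heights la e1. r h = k} = card {h \<in> weighted_heights la e2. r h = k}"
    if "k \<in> R" for k
  proof -
    obtain h0 where h0: "h0 \<in> weighted_heights la e1 \<union> weighted_heights la e2" "k = r h0"
      using \<open>k \<in> R\<close> by (auto simp: R_def)
    have h: "h0 \<in> height_functions la"
      using h0 by (auto simp: weighted_heights_def)
    have e': "e1 v = card {j. h0 v j < h0 (Suc v) j}" "e2 v = card {j. h0 v j < h0 (Suc v) j}"
      if "v \<noteq> q" "v \<noteq> Suc q" for v
    proof -
      have "e1 v = e2 v"
        using that by (simp add: e)
      then show "e1 v = card {j. h0 v j < h0 (Suc v) j}" "e2 v = card {j. h0 v j < h0 (Suc v) j}"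
        using h0(1) by (auto simp: weighted_heights_def)
    qed
    have "antimono (h0 q)" "antimono (h0 (Suc (Suc q)))" "h0 q \<le> h0 (Suc (Suc q))"
      using h height_functions_mono[OF h, of q "Suc (Suc q)"] by (auto simp: height_functions_def)
    moreover have "\<forall>j\<ge>sum_list la. h0 (Suc (Suc q)) j = 0"
      using height_functions_le_column_length[OF h, of "Suc (Suc q)"] column_length_eq_0[of la]
      by (metis le_funE le_zero_eq)
    ultimately show ?thesis
      using weighted_heights_fiber[OF h, of q e1] weighted_heights_fiber[OF h, of q e2] e'
        card_cuts_symmetric[of "h0 q" "h0 (Suc (Suc q))" "sum_list la" "e1 q" "e1 (Suc q)"]
      by (simp add: h0(2) r_def e)
  qed
  then show ?thesis
    by (simp add: card)
qed

lemma lookup_map_key_permutation: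
  "permutation \<pi> \<Longrightarrow> poly_mapping.lookup (Poly_Mapping.map_key \<pi> m) = poly_mapping.lookup m \<circ> \<pi>"
  by (simp add: map_key.rep_eq permutation_bijective bij_is_inj)

lemma coeff_dual_grothendieck_adjacent:
  assumes "la \<in> partitions"
  shows "coeff (dual_grothendieck la) (Poly_Mapping.map_key (transpose q (Suc q)) m) =
    coeff (dual_grothendieck la) m"
proof -
  let ?m' = "Poly_Mapping.map_key (transpose q (Suc q)) m"
  have "finite (weighted_heights la (poly_mapping.lookup m))" for m
    using bij_betw_finite[OF bij_betw_weighted_heights[OF assms, of m]] finite_rpps_weight[of la m]
    by simp
  moreover have "poly_mapping.lookup ?m' = poly_mapping.lookup m \<circ> transpose q (Suc q)"
    by (simp add: lookup_map_key_permutation permutation_swap_id)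
  ultimately have "card (weighted_heights la (poly_mapping.lookup m)) =
      card (weighted_heights la (poly_mapping.lookup ?m'))"
    by (intro card_weighted_heights_swap[where q = q]) metis+
  then show ?thesis
    using bij_betw_same_card[OF bij_betw_weighted_heights[OF assms, of m]]
      bij_betw_same_card[OF bij_betw_weighted_heights[OF assms, of ?m']]
    by (simp add: coeff_dual_grothendieck)
qed

section \<open>From adjacent transpositions to all finitary permutations\<close>

lemma map_key_comp_permutation:
  assumes "permutation \<pi>" "permutation \<sigma>"
  shows "Poly_Mapping.map_key (\<pi> \<circ> \<sigma>) m = Poly_Mapping.map_key \<sigma> (Poly_Mapping.map_key \<pi> m)"
  using assms by (simp add: map_key_compose permutation_bijective bij_is_inj)

lemma symmetric_if_adjacent:
  assumes adj: "\<And>q m. coeff f (Poly_Mapping.map_key (transpose q (Suc q)) m) = coeff f m"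
  shows "symmetric f"
proof -
  have transp: "coeff f (Poly_Mapping.map_key (transpose a (a + Suc d)) m) = coeff f m" for a d m
  proof (induction d arbitrary: m)
    case (Suc d)
    let ?b = "a + Suc d"
    \<comment> \<open>Conjugation by an adjacent transposition increases the distance of the two
      swapped points by one.\<close>
    have "transpose a (Suc ?b) = transpose ?b (Suc ?b) \<circ> transpose a ?b \<circ> transpose ?b (Suc ?b)"
      by (auto simp: fun_eq_iff transpose_def)
    then show ?case
      by (simp only: map_key_comp_permutation permutation_compose permutation_swap_id adj
          add_Suc_right Suc[unfolded add_Suc_right])
  qed (simp add: adj)
  have *: "coeff f (Poly_Mapping.map_key (transpose a b) m) = coeff f m" if "a \<noteq> b" for a b m
  proof (cases "a < b")
    case True
    then show ?thesis
      using transp[of a "b - Suc a" m] by simp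
  next
    case False
    then show ?thesis
      using transp[of b "a - Suc b" m] that by (simp add: transpose_commute)
  qed
  have "coeff f (Poly_Mapping.map_key \<pi> m) = coeff f m" if "swapidseq n \<pi>" for n \<pi> m
    using that
  proof (induction arbitrary: m)
    case (comp_Suc n p a b)
    then have "permutation p"
      by (auto simp: permutation_def)
    then show ?case
      using comp_Suc by (simp only: map_key_comp_permutation permutation_swap_id * not_False_eq_True)
  qed (simp add: id_def map_key_id)
  then show ?thesis
    by (auto simp: symmetric_def permutation_def)
qed

subsection \<open>Triangularity\<close>

lemma symmetric_dual_grothendieck: "la \<in> partitions \<Longrightarrow> symmetric (dual_grothendieck la)"
  by (rule symmetric_if_adjacent) (rule coeff_dual_grothendieck_adjacent)

section \<open>Dominance of the exponent vectors by the shape\<close>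

definition partial_sum :: "monomial \<Rightarrow> nat \<Rightarrow> nat" where
  "partial_sum m K = (\<Sum>k<K. poly_mapping.lookup m k)"

text \<open>The shift by one matches exponent vectors, where index \<open>k\<close> belongs to the
  entry \<open>Suc k\<close>.\<close>

definition values_in_column :: "nat list \<Rightarrow> (nat \<times> nat \<Rightarrow> nat) \<Rightarrow> nat \<Rightarrow> nat set" where
  "values_in_column la T j = {k. \<exists>i. (i, j) \<in> diagram la \<and> T (i, j) = Suc k}"

lemma card_row: "card {j. (i, j) \<in> diagram la} = nth_default 0 la i"
  by (simp add: diagram_def nth_default_def)

lemma diagram_column_less: "(i, j) \<in> diagram la \<Longrightarrow> j < sum_list la"
  by (auto simp: diagram_def dest: elem_le_sum_list)

text \<open>Double counting of the related pairs \<open>(k, j)\<close>, used to pass from variables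
  to columns.\<close>

lemma sum_card_swap:
  fixes R :: "nat \<Rightarrow> nat \<Rightarrow> bool"
  assumes "\<And>k j. R k j \<Longrightarrow> j < n"
  shows "(\<Sum>k<K. card {j. R k j}) = (\<Sum>j<n. card {k. k < K \<and> R k j})"
proof -
  have "(\<Sum>k<K. card {j. R k j}) = (\<Sum>k<K. \<Sum>j<n. if R k j then 1 else 0)"
    using assms by (intro sum.cong refl) (auto simp: sum.If_cases intro!: arg_cong[where f = card])
  also have "\<dots> = (\<Sum>j<n. \<Sum>k<K. if R k j then 1 else 0)"
    by (rule sum.swap)
  also have "\<dots> = (\<Sum>j<n. card {k. k < K \<and> R k j})"
    by (intro sum.cong refl) (auto simp: sum.If_cases intro!: arg_cong[where f = card])
  finally show ?thesis .
qed

lemma partial_sum_weight: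
  assumes "has_weight la T m"
  shows "partial_sum m K = (\<Sum>j<sum_list la. card {k. k < K \<and> k \<in> values_in_column la T j})"
proof -
  have "partial_sum m K = (\<Sum>k<K. card {j. k \<in> values_in_column la T j})"
    using assms by (simp add: partial_sum_def has_weight_def columns_containing_def values_in_column_def)
  also have "\<dots> = (\<Sum>j<sum_list la. card {k. k < K \<and> k \<in> values_in_column la T j})"
    by (rule sum_card_swap) (auto simp: values_in_column_def dest: diagram_column_less)
  finally show ?thesis .
qed

lemma partial_sum_shape:
  "partial_sum (Poly_Mapping.nth la) K = (\<Sum>j<sum_list la. card {i. i < K \<and> (i, j) \<in> diagram la})"
  unfolding partial_sum_def nth.rep_eq card_row[symmetric]
  by (rule sum_card_swap) (rule diagram_column_less)

lemma card_values_in_column_le: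
  assumes la: "la \<in> partitions"
  shows "card {k. k < K \<and> k \<in> values_in_column la T j} \<le> card {i. i < K \<and> (i, j) \<in> diagram la}"
proof -
  have col: "{i. (i, j) \<in> diagram la} = {..<column_length la j}"
    using less_column_length_iff[OF la] by auto
  have "values_in_column la T j \<subseteq> (\<lambda>i. T (i, j) - 1) ` {i. (i, j) \<in> diagram la}"
    by (force simp: values_in_column_def)
  then have "{k. k < K \<and> k \<in> values_in_column la T j} \<subseteq> (\<lambda>i. T (i, j) - 1) ` {..<column_length la j}"
    unfolding col by blast
  from surj_card_le[OF finite_lessThan this]
  have "card {k. k < K \<and> k \<in> values_in_column la T j} \<le> column_length la j"
    by simp
  moreover have "card {k. k < K \<and> k \<in> values_in_column la T j} \<le> card {..<K}"
    by (rule card_mono) auto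
  moreover have "{i. i < K \<and> (i, j) \<in> diagram la} = {..<min K (column_length la j)}"
    using less_column_length_iff[OF la] by auto
  ultimately show ?thesis
    by simp
qed

lemma partial_sum_dominance:
  assumes "la \<in> partitions" "has_weight la T m"
  shows "partial_sum m K \<le> partial_sum (Poly_Mapping.nth la) K"
  unfolding partial_sum_weight[OF assms(2)] partial_sum_shape
  by (intro sum_mono card_values_in_column_le assms)

lemma card_less_Suc_filter:
  "card {k. k < Suc K \<and> P k} = card {k. k < K \<and> P k} + (if P K then 1 else 0)"
proof -
  have "{k. k < Suc K \<and> P k} = (if P K then insert K {k. k < K \<and> P k} else {k. k < K \<and> P k})"
    by (auto simp: less_Suc_eq)
  then show ?thesis
    by simp
qed

text \<open>The increment of the count from \<open>k\<close> to \<open>Suc k\<close> tells whether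
  \<open>k\<close> satisfies the predicate.\<close>

lemma eq_if_card_less_eq:
  fixes P Q :: "nat \<Rightarrow> bool"
  assumes "\<And>K. card {k. k < K \<and> P k} = card {k. k < K \<and> Q k}"
  shows "P k \<longleftrightarrow> Q k"
  using assms[of "Suc k"] assms[of k] by (simp add: card_less_Suc_filter split: if_splits)

definition superstandard :: "nat list \<Rightarrow> nat \<times> nat \<Rightarrow> nat" where
  "superstandard la = (\<lambda>(i, j). if (i, j) \<in> diagram la then Suc i else 0)"

lemma superstandard_in_rpps: "superstandard la \<in> rpps la"
  by (auto simp: superstandard_def rpps_def)

lemma has_weight_superstandard: "has_weight la (superstandard la) (Poly_Mapping.nth la)"
proof -
  have "{j. \<exists>i. (i, j) \<in> diagram la \<and> superstandard la (i, j) = Suc k} = {j. (k, j) \<in> diagram la}" for k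
    by (auto simp: superstandard_def)
  then show ?thesis
    by (simp add: has_weight_def columns_containing_def nth.rep_eq card_row)
qed

text \<open>Equality in the dominance bound forces equality in every column. A column of length
  \<open>c\<close> then has exactly the values from 1 to \<open>c\<close>, and weak increase leaves
  only one order for them.\<close>

lemma rpps_shape_weight_unique:
  assumes la: "la \<in> partitions" and T: "T \<in> rpps la" and w: "has_weight la T (Poly_Mapping.nth la)"
  shows "T = superstandard la"
proof (rule ext)
  fix b :: "nat \<times> nat"
  obtain i j where b: "b = (i, j)"
    by (cases b)
  show "T b = superstandard la b"
  proof (cases "b \<in> diagram la")
    case True
    define c where "c = column_length la j"
    have c: "i' < c \<longleftrightarrow> (i', j) \<in> diagram la" for i'
      by (simp add: c_def less_column_length_iff[OF la])
    have "j < sum_list la"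
      using True by (auto simp: b dest: diagram_column_less)
    \<comment> \<open>Both sides have the same sum over all columns and are comparable column by
      column, so they agree in each.\<close>
    have "card {k. k < K \<and> k \<in> values_in_column la T j} = card {i. i < K \<and> (i, j) \<in> diagram la}" for K
      by (rule sum_mono_inv[OF partial_sum_weight[OF w, unfolded partial_sum_shape, symmetric]
            card_values_in_column_le[OF la]])
        (use \<open>j < sum_list la\<close> in auto)
    then have V: "k \<in> values_in_column la T j \<longleftrightarrow> k < c" for k
      unfolding c by (rule eq_if_card_less_eq)
    define xs where "xs = map (\<lambda>i. T (i, j)) [0..<c]"
    have set_xs: "set xs = set (map Suc [0..<c])"
    proof (intro set_eqI iffI)
      fix v assume "v \<in> set xs"
      then obtain i' where i': "i' < c" "v = T (i', j)"
        by (auto simp: xs_def)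
      then have "v = Suc (v - 1)"
        using rppsD(2)[OF T, of "(i', j)"] c by auto
      then have "v - 1 \<in> values_in_column la T j"
        using i' c by (auto simp: values_in_column_def)
      then show "v \<in> set (map Suc [0..<c])"
        using V \<open>v = Suc (v - 1)\<close> by (auto intro!: image_eqI[of _ _ "v - 1"])
    next
      fix v assume "v \<in> set (map Suc [0..<c])"
      then obtain k where "v = Suc k" "k \<in> values_in_column la T j"
        using V by - (cases v, auto)
      then show "v \<in> set xs"
        using c by (auto simp: values_in_column_def xs_def intro: rev_image_eqI)
    qed
    \<comment> \<open>There are \<open>c\<close> values in \<open>c\<close> boxes, so no value
      repeats.\<close>
    have "card (set xs) = length xs"
      unfolding set_xs by (simp add: xs_def)
    then have "distinct xs"
      by (rule card_distinct)
    moreover have "sorted xs"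
      unfolding sorted_iff_nth_mono
    proof (intro allI impI)
      fix i1 i2 assume "i1 \<le> i2" "i2 < length xs"
      then have "i1 < c" "i2 < c"
        by (simp_all add: xs_def)
      then show "xs ! i1 \<le> xs ! i2"
        using rpps_mono(2)[OF T] \<open>i1 \<le> i2\<close> c by (simp add: xs_def)
    qed
    moreover have "sorted (map Suc [0..<c])"
      by (simp add: sorted_iff_nth_mono)
    moreover have "distinct (map Suc [0..<c])"
      by (simp add: distinct_map)
    ultimately have "xs = map Suc [0..<c]"
      using set_xs by (metis sorted_distinct_set_unique)
    then have "xs ! i = Suc i"
      using True c by (simp add: b)
    then show ?thesis
      using True c by (simp add: b xs_def superstandard_def)
  next
    case False
    then show ?thesis
      using rppsD(1)[OF T False] by (simp add: b superstandard_def)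
  qed
qed

lemma coeff_dual_grothendieck_shape:
  assumes "la \<in> partitions"
  shows "coeff (dual_grothendieck la) (Poly_Mapping.nth la) = 1"
proof -
  have "{T \<in> rpps la. has_weight la T (Poly_Mapping.nth la)} = {superstandard la}"
    using rpps_shape_weight_unique[OF assms] superstandard_in_rpps has_weight_superstandard by blast
  then show ?thesis
    by (simp add: coeff_dual_grothendieck)
qed

lemma coeff_dual_grothendieck_dominance:
  assumes "la \<in> partitions" "coeff (dual_grothendieck la) m \<noteq> 0"
  shows "partial_sum m K \<le> partial_sum (Poly_Mapping.nth la) K"
proof -
  have "{T \<in> rpps la. has_weight la T m} \<noteq> {}"
    using assms(2) unfolding coeff_dual_grothendieck by (metis card.empty of_nat_0)
  then show ?thesis
    using partial_sum_dominance[OF assms(1)] by blast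
qed

lemma mdegree_eq_partial_sum: "Poly_Mapping.keys m \<subseteq> {..<K} \<Longrightarrow> mdegree m = partial_sum m K"
  unfolding mdegree_def partial_sum_def by (intro sum.mono_neutral_left) (auto simp: in_keys_iff)

lemma keys_subset_lessThan: "\<exists>K. Poly_Mapping.keys (m :: monomial) \<subseteq> {..<K}"
  using finite_nat_iff_bounded finite_keys by blast

lemma keys_nth_subset: "Poly_Mapping.keys (Poly_Mapping.nth la :: monomial) \<subseteq> {..<length la}"
  by (auto simp: in_keys_iff nth.rep_eq nth_default_def simp del: keys_nth split: if_splits)

lemma mdegree_nth: "mdegree (Poly_Mapping.nth la) = sum_list la"
  unfolding mdegree_eq_partial_sum[OF keys_nth_subset] partial_sum_def sum_list_sum_nth
  by (simp add: nth.rep_eq nth_default_nth atLeast0LessThan)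

lemma mdegree_coeff_dual_grothendieck:
  assumes "la \<in> partitions" "coeff (dual_grothendieck la) m \<noteq> 0"
  shows "mdegree m \<le> sum_list la"
proof -
  obtain K where "Poly_Mapping.keys m \<subseteq> {..<K}"
    using keys_subset_lessThan by blast
  \<comment> \<open>The index lies beyond the supports of both exponent vectors, so both partial
    sums there are full degrees.\<close>
  then have "mdegree m = partial_sum m (max K (length la))"
    by (intro mdegree_eq_partial_sum) auto
  also have "\<dots> \<le> partial_sum (Poly_Mapping.nth la) (max K (length la))"
    by (rule coeff_dual_grothendieck_dominance[OF assms])
  also have "\<dots> = mdegree (Poly_Mapping.nth la)"
    by (intro mdegree_eq_partial_sum[symmetric] order_trans[OF keys_nth_subset]) simp
  finally show ?thesis
    by (simp add: mdegree_nth)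
qed

lemma dual_grothendieck_in_Sym:
  assumes "la \<in> partitions"
  shows "dual_grothendieck la \<in> Sym"
  using symmetric_dual_grothendieck[OF assms] mdegree_coeff_dual_grothendieck[OF assms]
  by (auto simp: Sym_def bounded_degree_def)

lemma nth_default_eq_0_iff:
  "la \<in> partitions \<Longrightarrow> nth_default 0 la k = 0 \<longleftrightarrow> length la \<le> k"
  by (auto simp: nth_default_def partitions_def)

text \<open>Parts are positive, so the length of a partition is the first index at which its
  zero-padded sequence vanishes.\<close>

lemma nth_monomial_inj:
  assumes "la \<in> partitions" "mu \<in> partitions" "\<And>k. nth_default 0 la k = nth_default 0 mu k"
  shows "la = mu"
proof (rule nth_equalityI)
  have "length la \<le> k \<longleftrightarrow> length mu \<le> k" for k
    using nth_default_eq_0_iff[OF assms(1)] nth_default_eq_0_iff[OF assms(2)] assms(3) by metis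
  from this[of "length la"] this[of "length mu"] show len: "length la = length mu"
    by simp
  show "la ! k = mu ! k" if "k < length la" for k
    using assms(3)[of k] that len by (simp add: nth_default_def)
qed

lemma length_partition_le: "la \<in> partitions \<Longrightarrow> length la \<le> sum_list la"
  by (induction la) (auto simp: partitions_def)

text \<open>
  A linear refinement of the dominance order on partitions of size at most \<open>d\<close>, which also have at
  most \<open>d\<close> parts, so that the partial sums up to \<open>d\<close> determine them.
\<close>

definition rank :: "nat \<Rightarrow> nat list \<Rightarrow> nat" where
  "rank d la = (\<Sum>K\<le>d. partial_sum (Poly_Mapping.nth la) K)"

text \<open>Dominance bounds each partial sum of \<open>mu\<close> by that of \<open>la\<close>,
  while the ranks compare the other way; hence all partial sums up to \<open>d\<close>
  agree.\<close>

lemma coeff_dual_grothendieck_triangular: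
  assumes la: "la \<in> partitions" "sum_list la \<le> d" and mu: "mu \<in> partitions" "sum_list mu \<le> d"
    and c: "coeff (dual_grothendieck la) (Poly_Mapping.nth mu) \<noteq> 0" and r: "rank d la \<le> rank d mu"
  shows "mu = la"
proof (rule nth_monomial_inj[OF mu(1) la(1)])
  fix k
  have le: "partial_sum (Poly_Mapping.nth mu) K \<le> partial_sum (Poly_Mapping.nth la) K" for K
    by (rule coeff_dual_grothendieck_dominance[OF la(1) c])
  have "rank d mu = rank d la"
    using r le by (auto simp: rank_def intro!: antisym sum_mono)
  then have eq: "partial_sum (Poly_Mapping.nth mu) K = partial_sum (Poly_Mapping.nth la) K" if "K \<le> d" for K
    unfolding rank_def by (rule sum_mono_inv[OF _ le]) (use that in auto)
  show "nth_default 0 mu k = nth_default 0 la k"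
  proof (cases "k < d")
    case True
    then show ?thesis
      using eq[of "Suc k"] eq[of k] by (simp add: partial_sum_def nth.rep_eq)
  next
    case False
    then show ?thesis
      using length_partition_le[OF la(1)] length_partition_le[OF mu(1)] la(2) mu(2)
      by (simp add: nth_default_def)
  qed
qed

section \<open>Injectivity and linear independence\<close>

lemma inj_on_dual_grothendieck: "inj_on dual_grothendieck partitions"
proof (rule inj_onI)
  fix la mu
  assume *: "la \<in> partitions" "mu \<in> partitions" "dual_grothendieck la = dual_grothendieck mu"
  define d where "d = max (sum_list la) (sum_list mu)"
  \<comment> \<open>Each shape monomial occurs in both series, so triangularity applies in whichever
    direction the ranks allow.\<close>
  have "coeff (dual_grothendieck la) (Poly_Mapping.nth mu) \<noteq> 0"
    "coeff (dual_grothendieck mu) (Poly_Mapping.nth la) \<noteq> 0"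
    using coeff_dual_grothendieck_shape[OF *(1)] coeff_dual_grothendieck_shape[OF *(2)] *(3)
    by simp_all
  moreover have "sum_list la \<le> d" "sum_list mu \<le> d"
    by (simp_all add: d_def)
  ultimately show "la = mu"
    using coeff_dual_grothendieck_triangular[of la d mu] coeff_dual_grothendieck_triangular[of mu d la]
      *(1,2)
      linear[of "rank d la" "rank d mu"]
    by auto
qed

lemma finite_partitions_bounded: "finite {la \<in> partitions. sum_list la \<le> d}"
proof (rule finite_subset)
  show "{la \<in> partitions. sum_list la \<le> d} \<subseteq> {xs. set xs \<subseteq> {..d} \<and> length xs \<le> d}"
    using order_trans[OF length_partition_le] order_trans[OF member_le_sum_list] by blast
qed (simp add: finite_lists_length_le)

text \<open>In a vanishing combination choose \<open>mu\<close> of maximal rank among the shapes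
  with nonzero coefficient. By triangularity only \<open>mu\<close> itself contributes to the
  monomial of \<open>mu\<close>.\<close>

lemma independent_dual_grothendieck: "\<not> Zmod.dependent (dual_grothendieck ` partitions)"
proof
  assume "Zmod.dependent (dual_grothendieck ` partitions)"
  then obtain t u v where t: "finite t" "t \<subseteq> dual_grothendieck ` partitions"
    and sum: "(\<Sum>v\<in>t. of_int (u v) * v) = 0" and v: "v \<in> t" "u v \<noteq> 0"
    unfolding Zmod.dependent_explicit by blast
  obtain A where A: "A \<subseteq> partitions" "finite A" "t = dual_grothendieck ` A"
    using t by (meson finite_subset_image)
  define c where "c = u \<circ> dual_grothendieck"
  define B where "B = {la \<in> A. c la \<noteq> 0}"
  define d where "d = Max (sum_list ` A)"
  have d: "sum_list la \<le> d" if "la \<in> A" for la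
    using A(2) that by (simp add: d_def)
  have "finite B" "B \<noteq> {}"
    using A v by (auto simp: B_def c_def)
  then have "Max (rank d ` B) \<in> rank d ` B"
    by (intro Max_in) auto
  then obtain mu where mu: "mu \<in> B" and Max: "Max (rank d ` B) = rank d mu"
    by blast
  have max: "rank d la \<le> rank d mu" if "la \<in> B" for la
    using \<open>finite B\<close> that Max[symmetric] by simp
  have "0 = coeff (\<Sum>la\<in>A. of_int (c la) * dual_grothendieck la) (Poly_Mapping.nth mu)"
    using sum inj_on_subset[OF inj_on_dual_grothendieck A(1)]
    by (simp add: A(3) sum.reindex c_def zero_series.rep_eq)
  also have "\<dots> = (\<Sum>la\<in>A. c la * coeff (dual_grothendieck la) (Poly_Mapping.nth mu))"
    by (simp add: Defs.coeff_sum coeff_of_int_mult)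
  also have "\<dots> = (\<Sum>la\<in>{mu}. c la * coeff (dual_grothendieck la) (Poly_Mapping.nth mu))"
  proof (rule sum.mono_neutral_right)
    show "\<forall>la\<in>A - {mu}. c la * coeff (dual_grothendieck la) (Poly_Mapping.nth mu) = 0"
    proof
      fix la assume la: "la \<in> A - {mu}"
      show "c la * coeff (dual_grothendieck la) (Poly_Mapping.nth mu) = 0"
        using coeff_dual_grothendieck_triangular[of la d mu] la mu max A(1) d by (auto simp: B_def)
    qed
  qed (use A mu in \<open>auto simp: B_def\<close>)
  also have "\<dots> = c mu"
    using mu A by (simp add: coeff_dual_grothendieck_shape B_def subset_iff)
  finally show False
    using mu by (simp add: B_def)
qed

section \<open>Spanning\<close>

lemma nth_default_filter_pos:
  "sorted_wrt (\<ge>) ys \<Longrightarrow> nth_default (0::nat) (filter ((<) 0) ys) = nth_default 0 ys"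
proof (induction ys)
  case (Cons y ys)
  show ?case
  proof (cases "y = 0")
    case True
    \<comment> \<open>In a weakly decreasing list of natural numbers, everything after a zero is
      zero.\<close>
    then have zero: "\<forall>x\<in>set (y # ys). x = 0"
      using Cons.prems by auto
    then have "filter ((<) 0) (y # ys) = []"
      by (auto simp: filter_empty_conv)
    moreover have "nth_default 0 (y # ys) k = 0" for k
      using zero nth_mem[of k "y # ys"] unfolding nth_default_def by metis
    ultimately show ?thesis
      by (simp add: fun_eq_iff)
  next
    case False
    then show ?thesis
      using Cons by (auto simp: fun_eq_iff nth_default_Cons split: nat.split)
  qed
qed simp

text \<open>Sort the exponents below a bound of the support in decreasing order and drop the
  trailing zeros; this finds a partition in every orbit.\<close>

lemma ex_sorting_permutation:
  "\<exists>\<pi> la. permutation \<pi> \<and> la \<in> partitions \<and> Poly_Mapping.map_key \<pi> m = Poly_Mapping.nth la"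
proof -
  obtain K where K: "Poly_Mapping.keys m \<subseteq> {..<K}"
    using keys_subset_lessThan by blast
  define xs where "xs = map (poly_mapping.lookup m) [0..<K]"
  define ys where "ys = rev (sort xs)"
  obtain \<pi> where \<pi>: "\<pi> permutes {..<length xs}" "permute_list \<pi> xs = ys"
    using mset_eq_permutation[of ys xs] by (auto simp: ys_def)
  have perm: "permutation \<pi>"
    using \<pi>(1) by (auto simp: permutation_permutes)
  have "sorted_wrt (\<ge>) ys"
    by (simp add: ys_def sorted_wrt_rev)
  have "nth_default 0 ys k = poly_mapping.lookup m (\<pi> k)" for k
  proof (cases "k < K")
    case True
    then have "\<pi> k < K"
      using permutes_in_image[OF \<pi>(1), of k] by (simp add: xs_def)
    have "nth_default 0 ys k = xs ! \<pi> k"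
      using True \<pi> permute_list_nth[OF \<pi>(1), of k]
      by (simp add: nth_default_def xs_def ys_def)
    then show ?thesis
      using \<open>\<pi> k < K\<close> by (simp add: xs_def)
  next
    case False
    then have "\<pi> k = k"
      using permutes_not_in[OF \<pi>(1), of k] by (simp add: xs_def)
    moreover have "poly_mapping.lookup m k = 0"
      using K False by (auto simp: in_keys_iff)
    ultimately show ?thesis
      using False by (simp add: nth_default_def ys_def xs_def)
  qed
  then have "Poly_Mapping.map_key \<pi> m = Poly_Mapping.nth (filter ((<) 0) ys)"
    using nth_default_filter_pos[OF \<open>sorted_wrt (\<ge>) ys\<close>]
    by (intro poly_mapping_eqI) (simp add: lookup_map_key_permutation[OF perm] nth.rep_eq)
  moreover have "filter ((<) 0) ys \<in> partitions"
    using \<open>sorted_wrt (\<ge>) ys\<close> by (simp add: partitions_def sorted_wrt_filter)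
  ultimately show ?thesis
    using perm by blast
qed

lemma symmetric_eq_0:
  assumes "symmetric f" "\<And>la. la \<in> partitions \<Longrightarrow> coeff f (Poly_Mapping.nth la) = 0"
  shows "f = 0"
proof (rule series_eqI)
  fix m
  show "coeff f m = coeff 0 m"
    using ex_sorting_permutation[of m] assms unfolding symmetric_def
    by (metis zero_series.rep_eq)
qed

lemma Sym_scale: "f \<in> Sym \<Longrightarrow> of_int c * f \<in> Sym"
  by (auto simp: Sym_def symmetric_def bounded_degree_def coeff_of_int_mult)

lemma subspace_Sym: "Zmod.subspace Sym"
  by (simp add: Zmod.subspace_def Sym_zero Sym_add Sym_scale)

text \<open>Induction on the rank bound: subtracting suitable multiples of the series of rank
  \<open>n\<close> cancels the coefficients of \<open>f\<close> at all shapes of that rank. The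
  degree bound \<open>d\<close> stays fixed, so the same \<open>rank d\<close> serves
  throughout.\<close>

lemma Sym_span_aux:
  assumes "f \<in> Sym" "\<And>m. coeff f m \<noteq> 0 \<Longrightarrow> mdegree m \<le> d"
    and "\<And>la. la \<in> partitions \<Longrightarrow> coeff f (Poly_Mapping.nth la) \<noteq> 0 \<Longrightarrow> rank d la < n"
  shows "f \<in> Zmod.span (dual_grothendieck ` partitions)"
  using assms
proof (induction n arbitrary: f)
  case 0
  then have "f = 0"
    by (intro symmetric_eq_0) (auto simp: Sym_def)
  then show ?case
    by (simp add: Zmod.span_zero)
next
  case (Suc n)
  define S where "S = {la \<in> partitions. sum_list la \<le> d \<and> rank d la = n}"
  define h where "h = (\<Sum>la\<in>S. of_int (coeff f (Poly_Mapping.nth la)) * dual_grothendieck la)"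
  have S: "finite S" "S \<subseteq> partitions"
    using finite_subset[OF _ finite_partitions_bounded[of d], of S] by (auto simp: S_def)
  have coeff_h: "coeff h m = (\<Sum>la\<in>S. coeff f (Poly_Mapping.nth la) * coeff (dual_grothendieck la) m)" for m
    by (simp add: h_def Defs.coeff_sum coeff_of_int_mult)
  have span_h: "h \<in> Zmod.span (dual_grothendieck ` partitions)"
    unfolding h_def using S by (intro Zmod.span_sum Zmod.span_scale Zmod.span_base) auto
  have "f - h \<in> Zmod.span (dual_grothendieck ` partitions)"
  proof (rule Suc.IH)
    have "h \<in> Sym"
      unfolding h_def using S dual_grothendieck_in_Sym
      by (intro Zmod.subspace_sum[OF subspace_Sym] Sym_scale) auto
    then show "f - h \<in> Sym"
      by (intro Zmod.subspace_diff[OF subspace_Sym] Suc.prems(1))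
  next
    fix m assume "coeff (f - h) m \<noteq> 0"
    then consider "coeff f m \<noteq> 0" | "coeff h m \<noteq> 0"
      by (cases "coeff f m = 0") (auto simp: minus_series.rep_eq)
    then show "mdegree m \<le> d"
    proof cases
      case 2
      then obtain la where "la \<in> S" "coeff (dual_grothendieck la) m \<noteq> 0"
        unfolding coeff_h by (auto elim!: sum.not_neutral_contains_not_neutral)
      then show ?thesis
        using mdegree_coeff_dual_grothendieck[of la m] by (auto simp: S_def)
    qed (rule Suc.prems(2))
  next
    fix mu assume mu: "mu \<in> partitions" and "coeff (f - h) (Poly_Mapping.nth mu) \<noteq> 0"
    show "rank d mu < n"
    proof (rule ccontr)
      assume "\<not> rank d mu < n"
      \<comment> \<open>Every \<open>la\<close> in \<open>S\<close> has rank \<open>n\<close>, at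
        most that of \<open>mu\<close>, so triangularity excludes all but \<open>mu\<close>
        itself.\<close>
      have zero: "coeff (dual_grothendieck la) (Poly_Mapping.nth mu) = 0"
        if "la \<in> S" "la \<noteq> mu" "sum_list mu \<le> d" for la
        using coeff_dual_grothendieck_triangular[of la d mu] that mu \<open>\<not> rank d mu < n\<close>
        by (auto simp: S_def)
      have "coeff h (Poly_Mapping.nth mu) = coeff f (Poly_Mapping.nth mu)"
      proof (cases "mu \<in> S")
        case True
        then have "coeff h (Poly_Mapping.nth mu) =
            (\<Sum>la\<in>{mu}. coeff f (Poly_Mapping.nth la) * coeff (dual_grothendieck la) (Poly_Mapping.nth mu))"
          unfolding coeff_h using S zero by (intro sum.mono_neutral_right) (auto simp: S_def)
        then show ?thesis
          using mu by (simp add: coeff_dual_grothendieck_shape)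
      next
        case False
        \<comment> \<open>A nonzero coefficient would give \<open>mu\<close> size at most
          \<open>d\<close> and rank exactly \<open>n\<close>, placing it in
          \<open>S\<close>.\<close>
        have f0: "coeff f (Poly_Mapping.nth mu) = 0"
        proof (rule ccontr)
          assume c: "coeff f (Poly_Mapping.nth mu) \<noteq> 0"
          then show False
            using Suc.prems(2)[OF c] Suc.prems(3)[OF mu c] \<open>\<not> rank d mu < n\<close> False mu
            by (auto simp: S_def mdegree_nth)
        qed
        have "coeff (dual_grothendieck la) (Poly_Mapping.nth mu) = 0" if "la \<in> S" for la
        proof (rule ccontr)
          assume c: "coeff (dual_grothendieck la) (Poly_Mapping.nth mu) \<noteq> 0"
          have la: "la \<in> partitions" "sum_list la \<le> d" "la \<noteq> mu"
            using that False by (auto simp: S_def)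
          then have "sum_list mu \<le> d"
            using mdegree_coeff_dual_grothendieck[OF la(1) c] by (simp add: mdegree_nth)
          then show False
            using zero[OF that la(3)] c by simp
        qed
        then show ?thesis
          by (simp add: coeff_h f0)
      qed
      then show False
        using \<open>coeff (f - h) (Poly_Mapping.nth mu) \<noteq> 0\<close> by (simp add: minus_series.rep_eq)
    qed
  qed
  then have "(f - h) + h \<in> Zmod.span (dual_grothendieck ` partitions)"
    using span_h by (rule Zmod.span_add)
  then show ?case
    by simp
qed

lemma span_dual_grothendieck: "Zmod.span (dual_grothendieck ` partitions) = Sym"
proof
  show "Zmod.span (dual_grothendieck ` partitions) \<subseteq> Sym"
    using dual_grothendieck_in_Sym by (intro Zmod.span_minimal subspace_Sym) auto
  show "Sym \<subseteq> Zmod.span (dual_grothendieck ` partitions)"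
  proof
    fix f assume f: "f \<in> Sym"
    then obtain d where d: "\<And>m. coeff f m \<noteq> 0 \<Longrightarrow> mdegree m \<le> d"
      by (auto simp: Sym_def bounded_degree_def)
    \<comment> \<open>The degree bound leaves finitely many shapes, so their ranks have a
      maximum.\<close>
    define n where "n = Suc (Max (rank d ` {la \<in> partitions. sum_list la \<le> d}))"
    have "rank d la < n" if "la \<in> partitions" "coeff f (Poly_Mapping.nth la) \<noteq> 0" for la
      using d[OF that(2)] that(1) finite_partitions_bounded[of d]
      by (auto simp: n_def mdegree_nth less_Suc_eq_le)
    with f d show "f \<in> Zmod.span (dual_grothendieck ` partitions)"
      by (rule Sym_span_aux)
  qed
qed

theorem proposition9p10:
  shows "is_Z_basis dual_grothendieck partitions Sym
    \<and> (\<exists>\<phi>. Z_module_iso \<phi> MSym Sym)"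
proof
  show "is_Z_basis dual_grothendieck partitions Sym"
    by (simp add: is_Z_basis_def inj_on_dual_grothendieck independent_dual_grothendieck
        span_dual_grothendieck)
  \<comment> \<open>By the spanning result \<open>MSym\<close> and \<open>Sym\<close> are the same
    set of series.\<close>
  have "Z_module_iso id MSym Sym"
    by (simp add: Z_module_iso_def MSym_def span_dual_grothendieck)
  then show "\<exists>\<phi>. Z_module_iso \<phi> MSym Sym"
    by (rule exI[of _ id])
qed

end
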